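(* Consider the SEA model (see context) on $\mathcal{X}\subseteq\mathbb{R}^d$ with horizon $T$ (no smoothness assumed). Assume there are constants $G,D>0$ such that: (i) $\max_{\mathbf{x}\in\mathcal{X}}\|\nabla f_t(\mathbf{x})\|_2\le G$ for every individual function $f_t$, $t\in[T]$; (ii) $\mathbf{0}\in\mathcal{X}$ and $\|\mathbf{x}-\mathbf{y}\|_2\le D$ for all $\mathbf{x},\mathbf{y}\in\mathcal{X}$; (iii) every individual function $f_t$, $t\in[T]$, is convex on $\mathcal{X}$. Run the two-layer algorithm with implicit updates described in the context with step size pool $\{\eta_1,\dots,\eta_N\}$, $\eta_i=\frac{D}{\sqrt{1+4TG^2}}\cdot2^{i-1}$, $N=\lceil\frac12\log_2((1+2T)(1+4TG^2))\rceil+1$, and meta learning rate $$\epsilon_t=\frac1{\sqrt{1+\sum_{s=1}^t\big(\max_{i\in[N]}|\tilde f_s(\mathbf{x}_{s,i})-\tilde f_{s-1}(\mathbf{x}_{s,i})|\big)^2}},$$ where $\tilde f_s(\mathbf{x})=f_s(\mathbf{x})-f_s(\mathbf{x}_{\mathrm{ref}})$ for an arbitrary fixed reference point $\mathbf{x}_{\mathrm{ref}}\in\mathcal{X}$ and $f_0\equiv0$. Then for any comparator sequence $\mathbf{u}_1,\dots,\mathbf{u}_T\in\mathcal{X}$, $$\mathbb{E}\Big[\sum_{t=1}^Tf_t(\mathbf{x}_t)-\sum_{t=1}^Tf_t(\mathbf{u}_t)\Big]\le\mathcal{O}\Big(\sqrt{1+P_T}\Big(\sqrt{\tilde\sigma_{1:T}^2}+\sqrt{\Sigma_{1:T}^2}\Big)\Big),$$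 where $P_T=\mathbb{E}\big[\sum_{t=2}^T\|\mathbf{u}_t-\mathbf{u}_{t-1}\|_2\big]$.
   Context: SEA (Stochastically Extended Adversarial) model: $d,T\ge1$, $[T]=\{1,\dots,T\}$, and $\mathcal{X}\subseteq\mathbb{R}^d$ is a nonempty closed convex feasible domain. In each round $t\in[T]$ the learner selects $\mathbf{x}_t\in\mathcal{X}$ based on the previously observed functions $f_1,\dots,f_{t-1}$; nature chooses a distribution $\mathfrak{D}_t$ over differentiable functions $\mathcal{X}\to\mathbb{R}$ (possibly random, depending on the past); then the individual (random) function $f_t$ is sampled from $\mathfrak{D}_t$ (i.e. conditionally on the past and on $\mathfrak{D}_t$, $f_t$ has law $\mathfrak{D}_t$), the learner suffers $f_t(\mathbf{x}_t)$ and observes $f_t$. The (conditional) expected function is $F_t(\mathbf{x})=\mathbb{E}_{f_t\sim\mathfrak{D}_t}[f_t(\mathbf{x})]$, and differentiation and expectation may be interchanged: $\nabla F_t(\mathbf{x})=\mathbb{E}_{f_t\sim\mathfrak{D}_t}[\nabla f_t(\mathbf{x})]$. Define $$\tilde\sigma_t^2=\mathbb{E}_{f_t\sim\mathfrak{D}_t}\Big[\sup_{\mathbf{x}\in\mathcal{X}}\|\nabla f_t(\mathbf{x})-\nabla F_t(\mathbf{x})\|_2^2\Big],\quad \tilde\sigma_{1:T}^2=\mathbb{E}\Big[\sum_{t=1}^T\tilde\sigma_t^2\Big],\quad \Sigma_{1:T}^2=\mathbb{E}\Big[\sum_{t=1}^T\sup_{\mathbf{x}\in\mathcal{X}}\|\nabla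 F_t(\mathbf{x})-\nabla F_{t-1}(\mathbf{x})\|_2^2\Big],$$ with $\nabla F_0\equiv\mathbf 0$. Comparators: $\mathbf{u}_1,\dots,\mathbf{u}_T$ may depend on the expected functions $F_1,\dots,F_T$ but must be independent of the individual functions $f_1,\dots,f_T$; the expectation in $P_T$ is over their possible randomness. Algorithm: there are $N$ base-learners, the $i$-th with step size $\eta_i$. Initialize $\mathbf{x}_{1,i}=\hat{\mathbf{x}}_{1,i}\in\mathcal{X}$ arbitrarily and weights $p_{1,i}=1/N$. In round $t$ the learner plays $\mathbf{x}_t=\sum_{i=1}^Np_{t,i}\mathbf{x}_{t,i}$ and observes $f_t$; base-learner $i$ updates $$\hat{\mathbf{x}}_{t+1,i}=\Pi_{\mathcal{X}}[\hat{\mathbf{x}}_{t,i}-\eta_i\nabla f_t(\mathbf{x}_{t,i})],\qquad \mathbf{x}_{t+1,i}=\arg\min_{\mathbf{x}\in\mathcal{X}}f_t(\mathbf{x})+\frac1{2\eta_i}\|\mathbf{x}-\hat{\mathbf{x}}_{t+1,i}\|_2^2$$ ($\Pi_{\mathcal{X}}$ is Euclidean projection), and the weights $\mathbf p_{t+1}$ in the probability simplex are $p_{t+1,i}\propto\exp\big(-\epsilon_t(\sum_{s=1}^tf_s(\mathbf{x}_{s,i})+f_t(\mathbf{x}_{t+1,i}))\big)$. The $\mathcal{O}$-notation means: bounded by $C\sqrt{1+P_T}\,\big(1+\sqrt{\tilde\sigma_{1:T}^2}+\sqrt{\Sigma_{1:T}^2}\big)$, where $C$ depends only on $D,G$ and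 at most polynomially on $\ln N$ (a quantity of order $\log\log T$, treated as a constant). *)

theory Defs
  imports "HOL-Probability.Probability"
begin

section \<open>Differentiable functions on the feasible domain\<close>

text \<open>
  Loss functions are functions \<open>X \<rightarrow> \<real>\<close>, so derivatives are taken within \<open>X\<close>.  For a convex \<open>X\<close>
  with nonempty interior the condition on the span is void and \<open>gradient_on X f x\<close> is the usual
  gradient.  If \<open>X\<close> is contained in a proper affine subspace, \<open>f\<close> only determines the component of
  a gradient along the directions of \<open>X\<close>, and this component is the one selected.  If \<open>f\<close> extends
  differentiably to a neighbourhood of \<open>X\<close>, this is the orthogonal projection of the ambient
  gradient; its norm is not larger and it yields the same projected gradient step.
\<close>

definition gradient_on :: "'a::euclidean_space set \<Rightarrow> ('a \<Rightarrow> real) \<Rightarrow> 'a \<Rightarrow> 'a" where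
  "gradient_on X f x =
     (THE g. g \<in> span {y - z |y z. y \<in> X \<and> z \<in> X} \<and>
             (f has_derivative (\<lambda>h. g \<bullet> h)) (at x within X))"

text \<open>
  The measurable space of differentiable functions on \<open>X\<close> (extensional outside \<open>X\<close>), with the
  sigma-algebra generated by the point evaluations.  On it the gradients, and the suprema over \<open>X\<close>
  used below, are measurable: for a differentiable \<open>h\<close> on a convex \<open>X\<close>, the supremum of
  \<open>\<parallel>\<nabla>h\<parallel>\<close> is the Lipschitz constant of \<open>h\<close>.
\<close>

definition diff_fun_space :: "'a::euclidean_space set \<Rightarrow> ('a \<Rightarrow> real) measure" where
  "diff_fun_space X = restrict_space (\<Pi>\<^sub>M x\<in>X. borel) {\<phi>. \<phi> differentiable_on X}"

definition mean_fun :: "'a::euclidean_space set \<Rightarrow> ('a \<Rightarrow> real) measure \<Rightarrow> 'a \<Rightarrow> real" where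
  "mean_fun X Q = (\<lambda>x\<in>X. \<integral>\<phi>. \<phi> x \<partial>Q)"

definition grad_interchange :: "'a::euclidean_space set \<Rightarrow> ('a \<Rightarrow> real) measure \<Rightarrow> bool" where
  "grad_interchange X Q \<longleftrightarrow>
     (\<forall>x\<in>X. integrable Q (\<lambda>\<phi>. \<phi> x)) \<and>
     mean_fun X Q differentiable_on X \<and>
     (\<forall>x\<in>X. integrable Q (\<lambda>\<phi>. gradient_on X \<phi> x) \<and>
             gradient_on X (mean_fun X Q) x = (\<integral>\<phi>. gradient_on X \<phi> x \<partial>Q))"


section \<open>The stochastically extended adversarial model\<close>

text \<open>
  \<open>\<DD> t \<omega>\<close> is the distribution chosen by nature in round \<open>t\<close> and \<open>f t \<omega>\<close> the function drawn from it;
  both are indexed by \<open>t \<in> {1..T}\<close>.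
\<close>

definition history ::
  "'w measure \<Rightarrow> 'a::euclidean_space set \<Rightarrow> (nat \<Rightarrow> 'w \<Rightarrow> ('a \<Rightarrow> real) measure) \<Rightarrow>
   (nat \<Rightarrow> 'w \<Rightarrow> 'a \<Rightarrow> real) \<Rightarrow> nat \<Rightarrow> 'w measure" where
  "history M X \<DD> f t =
     vimage_algebra (space M)
       (\<lambda>\<omega>. (\<lambda>s\<in>{1..<t}. f s \<omega>, \<lambda>s\<in>{1..t}. \<DD> s \<omega>))
       ((\<Pi>\<^sub>M s\<in>{1..<t}. diff_fun_space X) \<Otimes>\<^sub>M (\<Pi>\<^sub>M s\<in>{1..t}. prob_algebra (diff_fun_space X)))"

definition SEA_model ::
  "'w measure \<Rightarrow> 'a::euclidean_space set \<Rightarrow> nat \<Rightarrow> (nat \<Rightarrow> 'w \<Rightarrow> ('a \<Rightarrow> real) measure) \<Rightarrow>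
   (nat \<Rightarrow> 'w \<Rightarrow> 'a \<Rightarrow> real) \<Rightarrow> bool" where
  "SEA_model M X T \<DD> f \<longleftrightarrow>
     prob_space M \<and>
     (\<forall>t\<in>{1..T}.
        \<DD> t \<in> M \<rightarrow>\<^sub>M prob_algebra (diff_fun_space X) \<and>
        f t \<in> M \<rightarrow>\<^sub>M diff_fun_space X \<and>
        (\<forall>A\<in>sets (diff_fun_space X). AE \<omega> in M.
           real_cond_exp M (history M X \<DD> f t) (indicator (f t -` A \<inter> space M)) \<omega>
             = measure (\<DD> t \<omega>) A) \<and>
        (\<forall>\<omega>\<in>space M. grad_interchange X (\<DD> t \<omega>)))"

definition expected_grad ::
  "'a::euclidean_space set \<Rightarrow> (nat \<Rightarrow> 'w \<Rightarrow> ('a \<Rightarrow> real) measure) \<Rightarrow> nat \<Rightarrow> 'w \<Rightarrow> 'a \<Rightarrow> 'a" where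
  "expected_grad X \<DD> t \<omega> x = (if t = 0 then 0 else gradient_on X (mean_fun X (\<DD> t \<omega>)) x)"

definition sigma_tilde_sq :: "'a::euclidean_space set \<Rightarrow> ('a \<Rightarrow> real) measure \<Rightarrow> real" where
  "sigma_tilde_sq X Q =
     (\<integral>\<phi>. (SUP x\<in>X. (norm (gradient_on X \<phi> x - gradient_on X (mean_fun X Q) x))\<^sup>2) \<partial>Q)"

definition cumulative_sigma_tilde_sq ::
  "'w measure \<Rightarrow> 'a::euclidean_space set \<Rightarrow> nat \<Rightarrow> (nat \<Rightarrow> 'w \<Rightarrow> ('a \<Rightarrow> real) measure) \<Rightarrow> real" where
  "cumulative_sigma_tilde_sq M X T \<DD> = (\<integral>\<omega>. (\<Sum>t=1..T. sigma_tilde_sq X (\<DD> t \<omega>)) \<partial>M)"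

definition cumulative_Sigma_sq ::
  "'w measure \<Rightarrow> 'a::euclidean_space set \<Rightarrow> nat \<Rightarrow> (nat \<Rightarrow> 'w \<Rightarrow> ('a \<Rightarrow> real) measure) \<Rightarrow> real" where
  "cumulative_Sigma_sq M X T \<DD> =
     (\<integral>\<omega>. (\<Sum>t=1..T. SUP x\<in>X.
        (norm (expected_grad X \<DD> t \<omega> x - expected_grad X \<DD> (t - 1) \<omega> x))\<^sup>2) \<partial>M)"


section \<open>Comparators\<close>

definition cond_indep_var ::
  "'w measure \<Rightarrow> 'w measure \<Rightarrow> 'b measure \<Rightarrow> ('w \<Rightarrow> 'b) \<Rightarrow> 'c measure \<Rightarrow> ('w \<Rightarrow> 'c) \<Rightarrow> bool" where
  "cond_indep_var M H M1 Y M2 Z \<longleftrightarrow>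
     Y \<in> M \<rightarrow>\<^sub>M M1 \<and> Z \<in> M \<rightarrow>\<^sub>M M2 \<and>
     (\<forall>A\<in>sets M1. \<forall>B\<in>sets M2. AE \<omega> in M.
        real_cond_exp M H (indicator (Y -` A \<inter> Z -` B \<inter> space M)) \<omega>
          = real_cond_exp M H (indicator (Y -` A \<inter> space M)) \<omega>
            * real_cond_exp M H (indicator (Z -` B \<inter> space M)) \<omega>)"

text \<open>
  The expected functions are themselves random and may depend on earlier individual functions.
  Hence ``may depend on the expected functions but is independent of the individual functions''
  is conditional independence given the expected functions.  It amounts to plain independence when
  nature's choices are deterministic.
\<close>

definition admissible_comparators ::
  "'w measure \<Rightarrow> 'a::euclidean_space set \<Rightarrow> nat \<Rightarrow> (nat \<Rightarrow> 'w \<Rightarrow> ('a \<Rightarrow> real) measure) \<Rightarrow>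
   (nat \<Rightarrow> 'w \<Rightarrow> 'a \<Rightarrow> real) \<Rightarrow> (nat \<Rightarrow> 'w \<Rightarrow> 'a) \<Rightarrow> bool" where
  "admissible_comparators M X T \<DD> f u \<longleftrightarrow>
     (\<forall>t\<in>{1..T}. u t \<in> borel_measurable M \<and> (\<forall>\<omega>\<in>space M. u t \<omega> \<in> X)) \<and>
     cond_indep_var M
       (vimage_algebra (space M) (\<lambda>\<omega>. \<lambda>t\<in>{1..T}. mean_fun X (\<DD> t \<omega>))
          (\<Pi>\<^sub>M t\<in>{1..T}. \<Pi>\<^sub>M x\<in>X. borel))
       (\<Pi>\<^sub>M t\<in>{1..T}. borel) (\<lambda>\<omega>. \<lambda>t\<in>{1..T}. u t \<omega>)
       (\<Pi>\<^sub>M t\<in>{1..T}. diff_fun_space X) (\<lambda>\<omega>. \<lambda>t\<in>{1..T}. f t \<omega>)"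

definition path_length :: "'w measure \<Rightarrow> nat \<Rightarrow> (nat \<Rightarrow> 'w \<Rightarrow> 'a::euclidean_space) \<Rightarrow> real" where
  "path_length M T u = (\<integral>\<omega>. (\<Sum>t=2..T. norm (u t \<omega> - u (t - 1) \<omega>)) \<partial>M)"


section \<open>The two-layer algorithm with implicit updates\<close>

definition pool_size :: "real \<Rightarrow> nat \<Rightarrow> nat" where
  "pool_size G T = nat \<lceil>1 / 2 * log 2 ((1 + 2 * real T) * (1 + 4 * real T * G\<^sup>2))\<rceil> + 1"

definition step_size :: "real \<Rightarrow> real \<Rightarrow> nat \<Rightarrow> nat \<Rightarrow> real" where
  "step_size D G T i = D / sqrt (1 + 4 * real T * G\<^sup>2) * 2 ^ (i - 1)"

text \<open>In this section \<open>f t\<close> is the realised loss of round \<open>t \<ge> 1\<close>; round 0 stands for the zero loss.\<close>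

definition shifted_loss :: "(nat \<Rightarrow> 'a \<Rightarrow> real) \<Rightarrow> 'a \<Rightarrow> nat \<Rightarrow> 'a \<Rightarrow> real" where
  "shifted_loss f x_ref s x = (if s = 0 then 0 else f s x - f s x_ref)"

definition meta_rate ::
  "nat \<Rightarrow> (nat \<Rightarrow> 'a \<Rightarrow> real) \<Rightarrow> 'a \<Rightarrow> (nat \<Rightarrow> nat \<Rightarrow> 'a) \<Rightarrow> nat \<Rightarrow> real" where
  "meta_rate N f x_ref x t =
     1 / sqrt (1 + (\<Sum>s=1..t.
       (MAX i\<in>{1..N}. \<bar>shifted_loss f x_ref s (x s i) - shifted_loss f x_ref (s - 1) (x s i)\<bar>)\<^sup>2))"

definition meta_weight ::
  "nat \<Rightarrow> (nat \<Rightarrow> 'a \<Rightarrow> real) \<Rightarrow> 'a \<Rightarrow> (nat \<Rightarrow> nat \<Rightarrow> 'a) \<Rightarrow> nat \<Rightarrow> nat \<Rightarrow> real" where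
  "meta_weight N f x_ref x t i =
     exp (- meta_rate N f x_ref x t * ((\<Sum>s=1..t. f s (x s i)) + f t (x (t + 1) i)))"

text \<open>
  \<open>x0 i\<close> is the initial point of the \<open>i\<close>-th base-learner, \<open>xh t i\<close> and \<open>x t i\<close> are its iterates,
  \<open>p t i\<close> is its weight and \<open>play t\<close> is the decision of the learner.
\<close>

definition two_layer_run ::
  "'a::euclidean_space set \<Rightarrow> nat \<Rightarrow> nat \<Rightarrow> (nat \<Rightarrow> real) \<Rightarrow> 'a \<Rightarrow> (nat \<Rightarrow> 'a) \<Rightarrow> (nat \<Rightarrow> 'a \<Rightarrow> real) \<Rightarrow>
   (nat \<Rightarrow> nat \<Rightarrow> 'a) \<Rightarrow> (nat \<Rightarrow> nat \<Rightarrow> 'a) \<Rightarrow> (nat \<Rightarrow> nat \<Rightarrow> real) \<Rightarrow> (nat \<Rightarrow> 'a) \<Rightarrow> bool" where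
  "two_layer_run X T N \<eta> x_ref x0 f xh x p play \<longleftrightarrow>
     (\<forall>i\<in>{1..N}. x 1 i = x0 i \<and> xh 1 i = x0 i \<and> p 1 i = 1 / real N) \<and>
     (\<forall>t\<in>{1..T}.
        play t = (\<Sum>i=1..N. p t i *\<^sub>R x t i) \<and>
        (\<forall>i\<in>{1..N}.
           xh (t + 1) i = closest_point X (xh t i - \<eta> i *\<^sub>R gradient_on X (f t) (x t i)) \<and>
           is_arg_min (\<lambda>y. f t y + 1 / (2 * \<eta> i) * (norm (y - xh (t + 1) i))\<^sup>2)
             (\<lambda>y. y \<in> X) (x (t + 1) i) \<and>
           p (t + 1) i = meta_weight N f x_ref x t i / (\<Sum>j=1..N. meta_weight N f x_ref x t j)))"


section \<open>The constant of the regret bound\<close>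

text \<open>
  The constant hidden in the \<open>O\<close>-notation may depend only on \<open>D\<close>, \<open>G\<close> and polynomially on \<open>ln N\<close>.
  It is given explicitly (without any claim of optimality), because an existentially quantified
  constant could still depend on the type variables of the theorem, that is, on the dimension and
  on the sample space.
\<close>

definition regret_const :: "real \<Rightarrow> real \<Rightarrow> nat \<Rightarrow> real" where
  "regret_const D G N = 20 * (1 + D)\<^sup>2 * (1 + G) * (1 + ln (real N))"

end

theory Submission
  imports Defs
begin

text \<open>
  Each base-learner is an optimistic mirror descent whose
  guess for \<open>f t\<close> is \<open>f (t - 1)\<close>; the implicit update makes the guess usable at the point where
  it is needed.  Its regret is controlled by the squared Lipschitz constants of
  \<open>f t - f (t - 1)\<close>, and the same quantities control the regret of the meta-learner, an optimistic
  Hedge algorithm analysed by a potential function that is antitone in the learning rate.  In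
  expectation, inserting \<open>F t\<close> and \<open>F (t - 1)\<close> bounds the sum of these squares by
  \<open>6 \<sigma>\<^sup>2 + 3 \<Sigma>\<^sup>2\<close>.  As all quantities are expressed by Lipschitz constants, which are suprema
  over a countable dense subset of \<open>X\<close>, they are measurable.
\<close>

section \<open>Gradients and Lipschitz seminorms on a convex domain\<close>

text \<open>Without smoothness, gradients of \<open>f (t - 1)\<close> and \<open>f t\<close> taken
  at different points cannot be compared. The first-order condition of the implicit step contains
  the gradient of \<open>f (t - 1)\<close> at the new iterate itself, so both gradients are compared
  at one and the same point. A single number per round, independent of the iterates, is then enough:
  a Lipschitz constant \<open>v t\<close> of \<open>f t - f (t - 1)\<close> bounds the gradient
  error of every base-learner, and \<open>v t * D\<close> bounds the error of the meta-learner's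
  guess.

  This independence matters for the expectation as well: no measurability of the iterates or of
  \<open>play\<close> is assumed, so the regret is dominated at each sample point by an integrable
  function of the variation and the path length only.

  The gradient bound \<open>G\<close> is assumed for the realised functions. The conditional law
  carries it over to almost every draw from \<open>\<DD> t \<omega>\<close>; this makes the suprema
  and integrals in the variance terms genuine rather than default values.

  The 3 in the variance bound comes from squaring a sum of three terms. The 6 arises because the
  deviation of each sample from its mean enters in two consecutive rounds.\<close>

abbreviation directions :: "'a::euclidean_space set \<Rightarrow> 'a set" where
  "directions X \<equiv> span {y - z |y z. y \<in> X \<and> z \<in> X}"

lemma segment_in_convex:
  assumes "convex X" "x \<in> X" "y \<in> X" "0 \<le> s" "s \<le> (1::real)"
  shows "x + s *\<^sub>R (y - x) \<in> X"
proof -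
  have "(1 - s) *\<^sub>R x + s *\<^sub>R y \<in> X"
    using assms by (simp add: convexD)
  then show ?thesis by (simp add: algebra_simps)
qed

text \<open>Chain rule along the segment from \<open>x\<close> to \<open>y\<close>. The limit is
  one-sided because \<open>x\<close> may lie on the boundary of \<open>X\<close>; all first-order
  arguments below use only such feasible segments.\<close>

lemma directional_limit:
  fixes h :: "'a::euclidean_space \<Rightarrow> real"
  assumes X: "convex X" and x: "x \<in> X" and y: "y \<in> X"
    and D: "(h has_derivative (\<lambda>v. g \<bullet> v)) (at x within X)"
  shows "((\<lambda>s. (h (x + s *\<^sub>R (y - x)) - h x) / s) \<longlongrightarrow> g \<bullet> (y - x)) (at_right 0)"
proof -
  let ?\<gamma> = "\<lambda>s::real. x + s *\<^sub>R (y - x)"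
  have \<gamma>: "(?\<gamma> has_derivative (\<lambda>s. s *\<^sub>R (y - x))) (at 0 within {0..1})"
    by (auto intro!: derivative_eq_intros)
  have sub: "?\<gamma> ` {0..1} \<subseteq> X"
    using segment_in_convex[OF X x y] by auto
  have "((\<lambda>s. h (?\<gamma> s)) has_derivative (\<lambda>s. g \<bullet> (s *\<^sub>R (y - x)))) (at 0 within {0..1})"
    by (rule has_derivative_in_compose[OF \<gamma>]) (use has_derivative_subset[OF D sub] in simp)
  then have "((\<lambda>s. h (?\<gamma> s)) has_real_derivative g \<bullet> (y - x)) (at 0 within {0..1})"
    by (simp add: has_field_derivative_def mult_commute_abs)
  then have "((\<lambda>s. (h (?\<gamma> s) - h x) / s) \<longlongrightarrow> g \<bullet> (y - x)) (at 0 within {0..1})"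
    by (simp add: has_field_derivative_iff)
  then show ?thesis
    by (simp add: at_within_Icc_at_right)
qed

text \<open>The directional limits fix the inner products with all \<open>y - x\<close>, and
  differences of these span \<open>directions X\<close>. Hence \<open>g - g'\<close> is a member of
  that space orthogonal to all of it, in particular to itself.\<close>

lemma gradient_unique:
  fixes h :: "'a::euclidean_space \<Rightarrow> real"
  assumes X: "convex X" and x: "x \<in> X"
    and g: "g \<in> directions X" "(h has_derivative (\<lambda>v. g \<bullet> v)) (at x within X)"
    and g': "g' \<in> directions X" "(h has_derivative (\<lambda>v. g' \<bullet> v)) (at x within X)"
  shows "g = g'"
proof -
  have eq: "g \<bullet> (y - x) = g' \<bullet> (y - x)" if "y \<in> X" for y
    using tendsto_unique[OF _ directional_limit[OF X x that g(2)] directional_limit[OF X x that g'(2)]]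
    by simp
  have "orthogonal (g - g') w" if "w \<in> directions X" for w
    using that
  proof (rule orthogonal_to_span)
    fix w assume "w \<in> {y - z |y z. y \<in> X \<and> z \<in> X}"
    then obtain y z where w: "w = (y - x) - (z - x)" "y \<in> X" "z \<in> X" by auto
    then show "orthogonal (g - g') w"
      using eq[of y] eq[of z] by (simp add: orthogonal_def inner_diff_left inner_diff_right w(1))
  qed
  moreover have "g - g' \<in> directions X" using g(1) g'(1) by (rule span_diff)
  ultimately have "orthogonal (g - g') (g - g')" by blast
  then show ?thesis by (simp add: orthogonal_def)
qed

lemma gradient_exists:
  fixes h :: "'a::euclidean_space \<Rightarrow> real"
  assumes h: "h differentiable (at x within X)" and x: "x \<in> X"
  shows "\<exists>g. g \<in> directions X \<and> (h has_derivative (\<lambda>v. g \<bullet> v)) (at x within X)"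
proof -
  obtain h' where h': "(h has_derivative h') (at x within X)"
    using h by (auto simp: differentiable_def)
  then interpret h': bounded_linear h' by (rule has_derivative_bounded_linear)
  define g0 where "g0 = (\<Sum>b\<in>Basis. h' b *\<^sub>R b)"
  have h'_eq: "h' v = g0 \<bullet> v" for v
  proof -
    have "h' v = h' (\<Sum>b\<in>Basis. (v \<bullet> b) *\<^sub>R b)" by (simp add: euclidean_representation)
    also have "\<dots> = (\<Sum>b\<in>Basis. (v \<bullet> b) * h' b)" by (simp add: h'.sum h'.scaleR)
    also have "\<dots> = g0 \<bullet> v"
      by (simp add: g0_def inner_sum_left inner_commute[of v] mult.commute)
    finally show ?thesis .
  qed
  \<comment> \<open>Project the Riesz representative \<open>g0\<close> onto the direction space. The
    discarded part \<open>k\<close> vanishes on all increments \<open>y - x\<close>, so the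
    derivative within \<open>X\<close> does not change.\<close>
  obtain g k where g: "g \<in> directions X" and k: "\<And>w. w \<in> directions X \<Longrightarrow> orthogonal k w"
    and g0: "g0 = g + k"
    using orthogonal_subspace_decomp_exists[of "{y - z |y z. y \<in> X \<and> z \<in> X}" g0] by blast
  have same: "h' (y - x) = g \<bullet> (y - x)" if "y \<in> X" for y
  proof -
    have "y - x \<in> directions X" using that x by (intro span_base) auto
    with k show ?thesis by (auto simp: h'_eq g0 inner_add_left orthogonal_def)
  qed
  have "((\<lambda>y. (h y - h x - g \<bullet> (y - x)) /\<^sub>R norm (y - x)) \<longlongrightarrow> 0) (at x within X)"
  proof (rule tendsto_cong[THEN iffD1])
    show "((\<lambda>y. (h y - h x - h' (y - x)) /\<^sub>R norm (y - x)) \<longlongrightarrow> 0) (at x within X)"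
      using h' by (simp add: has_derivative_at_within)
    show "\<forall>\<^sub>F y in at x within X. (h y - h x - h' (y - x)) /\<^sub>R norm (y - x)
        = (h y - h x - g \<bullet> (y - x)) /\<^sub>R norm (y - x)"
      by (auto simp: eventually_at_filter same)
  qed
  then have "(h has_derivative (\<lambda>v. g \<bullet> v)) (at x within X)"
    by (simp add: has_derivative_at_within bounded_linear_inner_right)
  with g show ?thesis by blast
qed

lemma gradient_on:
  fixes h :: "'a::euclidean_space \<Rightarrow> real"
  assumes "convex X" "x \<in> X" "h differentiable_on X"
  shows gradient_on_directions: "gradient_on X h x \<in> directions X"
    and gradient_on_has_derivative: "(h has_derivative (\<lambda>v. gradient_on X h x \<bullet> v)) (at x within X)"
proof -
  have "\<exists>!g. g \<in> directions X \<and> (h has_derivative (\<lambda>v. g \<bullet> v)) (at x within X)"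
    using gradient_exists[of h x X] gradient_unique[OF assms(1,2)] assms
    by (auto simp: differentiable_on_def)
  from theI'[OF this]
  show "gradient_on X h x \<in> directions X"
    "(h has_derivative (\<lambda>v. gradient_on X h x \<bullet> v)) (at x within X)"
    by (simp_all add: gradient_on_def)
qed

lemma gradient_on_eqI:
  fixes h :: "'a::euclidean_space \<Rightarrow> real"
  assumes "convex X" "x \<in> X" "g \<in> directions X" "(h has_derivative (\<lambda>v. g \<bullet> v)) (at x within X)"
  shows "gradient_on X h x = g"
  unfolding gradient_on_def
  using assms gradient_unique[OF assms(1,2)] by (intro the_equality) auto

lemma gradient_on_zero [simp]:
  assumes "convex X" "x \<in> X"
  shows "gradient_on X (\<lambda>_. 0) x = 0"
  using assms by (intro gradient_on_eqI) (auto intro: span_zero)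

lemma gradient_on_diff:
  assumes "convex X" "x \<in> X" "h differentiable_on X" "k differentiable_on X"
  shows "gradient_on X (\<lambda>y. h y - k y) x = gradient_on X h x - gradient_on X k x"
  using gradient_on[OF assms(1-3)] gradient_on[OF assms(1,2,4)] assms(1,2)
  by (intro gradient_on_eqI) (auto intro!: derivative_eq_intros span_diff simp: inner_diff_left)

definition lipschitz_bound :: "'a::euclidean_space set \<Rightarrow> real \<Rightarrow> ('a \<Rightarrow> real) \<Rightarrow> bool" where
  "lipschitz_bound X L h \<longleftrightarrow> (\<forall>y\<in>X. \<forall>z\<in>X. \<bar>h y - h z\<bar> \<le> L * norm (y - z))"

lemma lipschitz_boundD:
  "lipschitz_bound X L h \<Longrightarrow> y \<in> X \<Longrightarrow> z \<in> X \<Longrightarrow> \<bar>h y - h z\<bar> \<le> L * norm (y - z)"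
  by (simp add: lipschitz_bound_def)

lemma lipschitz_bound_diff:
  assumes "lipschitz_bound X L h" "lipschitz_bound X L' h'"
  shows "lipschitz_bound X (L + L') (\<lambda>y. h y - h' y)"
  unfolding lipschitz_bound_def
proof (intro ballI)
  fix y z assume "y \<in> X" "z \<in> X"
  then show "\<bar>h y - h' y - (h z - h' z)\<bar> \<le> (L + L') * norm (y - z)"
    using lipschitz_boundD[OF assms(1), of y z] lipschitz_boundD[OF assms(2), of y z]
    by (simp add: distrib_right)
qed

lemma lipschitz_bound_of_gradient:
  fixes h :: "'a::euclidean_space \<Rightarrow> real"
  assumes X: "convex X" and h: "h differentiable_on X"
    and L: "\<And>x. x \<in> X \<Longrightarrow> norm (gradient_on X h x) \<le> L"
  shows "lipschitz_bound X L h"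
  unfolding lipschitz_bound_def
proof (intro ballI)
  fix y z assume yz: "y \<in> X" "z \<in> X"
  have on: "onorm (\<lambda>v. gradient_on X h x \<bullet> v) \<le> L" if "x \<in> X" for x
  proof (rule onorm_le)
    fix v
    have "norm (gradient_on X h x \<bullet> v) \<le> norm (gradient_on X h x) * norm v"
      by (simp add: Cauchy_Schwarz_ineq2)
    also have "\<dots> \<le> L * norm v" using L[OF that] by (rule mult_right_mono) simp
    finally show "norm (gradient_on X h x \<bullet> v) \<le> L * norm v" .
  qed
  have "norm (h y - h z) \<le> L * norm (y - z)"
    using differentiable_bound[OF X gradient_on_has_derivative[OF X _ h] on] yz by blast
  then show "\<bar>h y - h z\<bar> \<le> L * norm (y - z)" by simp
qed

text \<open>
  At a relative boundary point \<open>x\<close> the gradient need not be a feasible direction.  Comparing the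
  points \<open>x + s (c - x)\<close> and \<open>x + s (c + w - x)\<close> for \<open>c\<close> in the relative interior and a small
  \<open>w\<close> parallel to the gradient avoids this problem.
\<close>

lemma gradient_le_lipschitz_bound:
  fixes h :: "'a::euclidean_space \<Rightarrow> real"
  assumes X: "convex X" and x: "x \<in> X" and h: "h differentiable_on X"
    and L: "lipschitz_bound X L h"
  shows "gradient_on X h x = 0 \<or> norm (gradient_on X h x) \<le> L"
proof (cases "gradient_on X h x = 0")
  case False
  define g where "g = gradient_on X h x"
  have g: "g \<in> directions X" "g \<noteq> 0" "(h has_derivative (\<lambda>v. g \<bullet> v)) (at x within X)"
    using gradient_on[OF X x h] False by (auto simp: g_def)
  obtain c where "c \<in> rel_interior X"
    using rel_interior_eq_empty[OF X] x by blast
  then obtain r where c: "c \<in> X" and r: "r > 0" "cball c r \<inter> affine hull X \<subseteq> X"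
    by (auto simp: mem_rel_interior_cball)
  define w where "w = (r / norm g) *\<^sub>R g"
  \<comment> \<open>This puts \<open>c + w\<close> into the affine hull, the only place where the
    ball around \<open>c\<close> is known to lie in \<open>X\<close>.\<close>
  have "directions X \<subseteq> (\<lambda>v. v - c) ` (affine hull X)"
  proof (rule span_minimal)
    show "subspace ((\<lambda>v. v - c) ` (affine hull X))"
      using c hull_inc by (intro affine_diffs_subspace_subtract) (auto intro: hull_inc)
    show "{y - z |y z. y \<in> X \<and> z \<in> X} \<subseteq> (\<lambda>v. v - c) ` (affine hull X)"
    proof clarify
      fix y z assume "y \<in> X" "z \<in> X"
      then have "c + 1 *\<^sub>R (y - z) \<in> affine hull X"
        by (intro mem_affine_3_minus) (auto intro: hull_inc c)
      then show "y - z \<in> (\<lambda>v. v - c) ` (affine hull X)"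
        by (auto intro!: image_eqI[where x = "c + (y - z)"])
    qed
  qed
  moreover have "w \<in> directions X" unfolding w_def using g(1) by (rule span_scale)
  ultimately have "c + w \<in> affine hull X" by auto
  moreover have nw: "norm w = r" using g(2) r(1) by (simp add: w_def)
  then have "c + w \<in> cball c r" by (simp add: dist_norm)
  ultimately have cw: "c + w \<in> X" using r(2) by blast
  have "((\<lambda>s. (h (x + s *\<^sub>R (c + w - x)) - h x) / s - (h (x + s *\<^sub>R (c - x)) - h x) / s)
      \<longlongrightarrow> g \<bullet> (c + w - x) - g \<bullet> (c - x)) (at_right 0)"
    by (intro tendsto_diff directional_limit[OF X x _ g(3)] cw c)
  then have lim: "((\<lambda>s. (h (x + s *\<^sub>R (c + w - x)) - h (x + s *\<^sub>R (c - x))) / s) \<longlongrightarrow> g \<bullet> w) (at_right 0)"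
    by (simp add: diff_divide_distrib inner_diff_right inner_add_right)
  have "\<forall>\<^sub>F s in at_right 0. (h (x + s *\<^sub>R (c + w - x)) - h (x + s *\<^sub>R (c - x))) / s \<le> L * r"
    using eventually_at_right_real[of 0 1]
  proof (rule eventually_mono)
    fix s :: real assume "s \<in> {0<..<1}"
    then have s: "0 < s" "0 \<le> s" "s \<le> 1" by auto
    have "h (x + s *\<^sub>R (c + w - x)) - h (x + s *\<^sub>R (c - x))
        \<le> L * norm ((x + s *\<^sub>R (c + w - x)) - (x + s *\<^sub>R (c - x)))"
      using lipschitz_boundD[OF L segment_in_convex[OF X x cw s(2,3)] segment_in_convex[OF X x c s(2,3)]]
      by linarith
    also have "(x + s *\<^sub>R (c + w - x)) - (x + s *\<^sub>R (c - x)) = s *\<^sub>R w"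
      by (simp add: algebra_simps)
    finally show "(h (x + s *\<^sub>R (c + w - x)) - h (x + s *\<^sub>R (c - x))) / s \<le> L * r"
      using s nw by (simp add: divide_le_eq mult_ac)
  qed simp
  then have "g \<bullet> w \<le> L * r"
    by (intro tendsto_upperbound[OF lim]) auto
  moreover have "g \<bullet> w = norm g * r"
    using g(2) by (simp add: w_def power2_norm_eq_inner[symmetric] power2_eq_square)
  ultimately show ?thesis using r(1) by (simp add: g_def)
qed simp

text \<open>The sign condition on \<open>L\<close> settles the case of a one-point \<open>X\<close>,
  where every number, even a negative one, is a Lipschitz bound.\<close>

lemma gradient_norm_le:
  fixes h :: "'a::euclidean_space \<Rightarrow> real"
  assumes "convex X" "x \<in> X" "h differentiable_on X" "lipschitz_bound X L h" "L \<ge> 0"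
  shows "norm (gradient_on X h x) \<le> L"
  using gradient_le_lipschitz_bound[OF assms(1-4)] assms(5) by auto

text \<open>By convexity every difference quotient towards \<open>y\<close> is at most
  \<open>h y - h x\<close>; this survives the limit at 0.\<close>

lemma convex_gradient_ineq:
  fixes h :: "'a::euclidean_space \<Rightarrow> real"
  assumes h: "convex_on X h" "h differentiable_on X" and x: "x \<in> X" and y: "y \<in> X"
  shows "h x + gradient_on X h x \<bullet> (y - x) \<le> h y"
proof -
  have X: "convex X" using h(1) by (rule convex_on_imp_convex)
  note lim = directional_limit[OF X x y gradient_on_has_derivative[OF X x h(2)]]
  have "\<forall>\<^sub>F s in at_right 0. (h (x + s *\<^sub>R (y - x)) - h x) / s \<le> h y - h x"
    using eventually_at_right_real[of 0 1]
  proof (rule eventually_mono)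
    fix s :: real assume "s \<in> {0<..<1}"
    then have s: "0 < s" "s < 1" by auto
    have "h ((1 - s) *\<^sub>R x + s *\<^sub>R y) \<le> (1 - s) * h x + s * h y"
      using convex_onD[OF h(1), of s x y] s x y by simp
    moreover have "(1 - s) *\<^sub>R x + s *\<^sub>R y = x + s *\<^sub>R (y - x)" by (simp add: algebra_simps)
    ultimately show "(h (x + s *\<^sub>R (y - x)) - h x) / s \<le> h y - h x"
      using s by (simp only: pos_divide_le_eq) (simp add: algebra_simps)
  qed simp
  then have "gradient_on X h x \<bullet> (y - x) \<le> h y - h x"
    by (intro tendsto_upperbound[OF lim]) auto
  then show ?thesis by simp
qed

text \<open>Variational inequality of the implicit update: compare the minimiser with
  \<open>x + s (y - x)\<close>, divide by \<open>s\<close> and let \<open>s\<close> tend to 0. The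
  gradient is taken at the minimiser, not at the centre \<open>a\<close>.\<close>

lemma proximal_optimality:
  fixes h :: "'a::euclidean_space \<Rightarrow> real"
  assumes X: "convex X" and h: "h differentiable_on X" and \<eta>: "\<eta> > 0" and y: "y \<in> X"
    and min: "is_arg_min (\<lambda>y. h y + 1 / (2 * \<eta>) * (norm (y - a))\<^sup>2) (\<lambda>y. y \<in> X) x"
  shows "0 \<le> gradient_on X h x \<bullet> (y - x) + (x - a) \<bullet> (y - x) / \<eta>"
proof -
  have x: "x \<in> X" using min by (simp add: is_arg_min_def)
  let ?d = "y - x"
  have "((\<lambda>s. (h (x + s *\<^sub>R ?d) - h x) / s + 1 / (2 * \<eta>) * (2 * ((x - a) \<bullet> ?d) + s * (norm ?d)\<^sup>2))
      \<longlongrightarrow> gradient_on X h x \<bullet> ?d + 1 / (2 * \<eta>) * (2 * ((x - a) \<bullet> ?d) + 0 * (norm ?d)\<^sup>2)) (at_right 0)"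
    by (intro tendsto_intros directional_limit[OF X x y] gradient_on_has_derivative[OF X x h])
  then have lim: "((\<lambda>s. (h (x + s *\<^sub>R ?d) - h x) / s + 1 / (2 * \<eta>) * (2 * ((x - a) \<bullet> ?d) + s * (norm ?d)\<^sup>2))
      \<longlongrightarrow> gradient_on X h x \<bullet> ?d + (x - a) \<bullet> ?d / \<eta>) (at_right 0)"
    by simp
  have "\<forall>\<^sub>F s in at_right 0. 0 \<le> (h (x + s *\<^sub>R ?d) - h x) / s
      + 1 / (2 * \<eta>) * (2 * ((x - a) \<bullet> ?d) + s * (norm ?d)\<^sup>2)"
    using eventually_at_right_real[of 0 1]
  proof (rule eventually_mono)
    fix s :: real assume "s \<in> {0<..<1}"
    then have s: "0 < s" "s \<le> 1" by auto
    have "h x + 1 / (2 * \<eta>) * (norm (x - a))\<^sup>2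
        \<le> h (x + s *\<^sub>R ?d) + 1 / (2 * \<eta>) * (norm (x + s *\<^sub>R ?d - a))\<^sup>2"
      using min segment_in_convex[OF X x y] s
      unfolding is_arg_min_linorder by simp
    moreover have "(norm (x + s *\<^sub>R ?d - a))\<^sup>2
        = (norm (x - a))\<^sup>2 + s * (2 * ((x - a) \<bullet> ?d) + s * (norm ?d)\<^sup>2)"
    proof -
      have eq: "x + s *\<^sub>R ?d - a = (x - a) + s *\<^sub>R ?d" by simp
      show ?thesis
        unfolding eq power2_norm_eq_inner
        by (simp only: inner_add_left inner_add_right inner_scaleR_left inner_scaleR_right
            inner_commute[of ?d "x - a"]) (simp add: algebra_simps)
    qed
    ultimately have "0 \<le> (h (x + s *\<^sub>R ?d) - h x)
        + s * (1 / (2 * \<eta>) * (2 * ((x - a) \<bullet> ?d) + s * (norm ?d)\<^sup>2))"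
      by (simp add: distrib_left mult_ac)
    then have "0 \<le> ((h (x + s *\<^sub>R ?d) - h x)
        + s * (1 / (2 * \<eta>) * (2 * ((x - a) \<bullet> ?d) + s * (norm ?d)\<^sup>2))) / s"
      using s by (intro divide_nonneg_pos) auto
    then show "0 \<le> (h (x + s *\<^sub>R ?d) - h x) / s
      + 1 / (2 * \<eta>) * (2 * ((x - a) \<bullet> ?d) + s * (norm ?d)\<^sup>2)"
      using s by (simp add: add_divide_distrib)
  qed simp
  then show ?thesis
    by (intro tendsto_lowerbound[OF lim]) auto
qed

section \<open>Regret of a base-learner\<close>

text \<open>Split \<open>g \<bullet> (x - u)\<close> into \<open>g \<bullet> (xh' - u)\<close>,
  \<open>m \<bullet> (x - xh')\<close> and \<open>(g - m) \<bullet> (x - xh')\<close>. The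
  projection bounds the first part, the optimality of \<open>x\<close> for the guess
  \<open>m\<close> the second, Cauchy-Schwarz and the inequality of means the third. The half square
  of \<open>norm (x - xh')\<close> created by the third part is exactly the negative term that
  polarisation produces from the other two.\<close>

lemma optimistic_mirror_step:
  fixes g m u xh x xh' :: "'a::euclidean_space"
  assumes X: "convex X" "closed X" and \<eta>: "\<eta> > 0" and u: "u \<in> X"
    and xh': "xh' = closest_point X (xh - \<eta> *\<^sub>R g)"
    and opt: "\<And>y. y \<in> X \<Longrightarrow> 0 \<le> m \<bullet> (y - x) + (x - xh) \<bullet> (y - x) / \<eta>"
    and v: "norm (g - m) \<le> v"
  shows "g \<bullet> (x - u) \<le> ((norm (u - xh))\<^sup>2 - (norm (u - xh'))\<^sup>2) / (2 * \<eta>) + \<eta> / 2 * v\<^sup>2"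
proof -
  have xh'X: "xh' \<in> X" unfolding xh' using X u by (intro closest_point_in_set) auto
  have "(xh - \<eta> *\<^sub>R g - xh') \<bullet> (u - xh') \<le> 0"
    unfolding xh' by (rule closest_point_dot[OF X u])
  then have 1: "\<eta> * (g \<bullet> (xh' - u)) \<le> (xh - xh') \<bullet> (xh' - u)"
    by (simp add: inner_diff_left inner_diff_right algebra_simps)
  have "0 \<le> \<eta> * (m \<bullet> (xh' - x) + (x - xh) \<bullet> (xh' - x) / \<eta>)"
    using opt[OF xh'X] \<eta> by (intro mult_nonneg_nonneg) auto
  also have "\<dots> = (x - xh) \<bullet> (xh' - x) - \<eta> * (m \<bullet> (x - xh'))"
    using \<eta> by (simp add: distrib_left) (simp add: inner_diff_right right_diff_distrib)
  finally have 2: "\<eta> * (m \<bullet> (x - xh')) \<le> (x - xh) \<bullet> (xh' - x)" by simp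
  have v0: "0 \<le> v" using v norm_ge_zero[of "g - m"] by linarith
  have "(g - m) \<bullet> (x - xh') \<le> norm (g - m) * norm (x - xh')" by (rule norm_cauchy_schwarz)
  also have "\<dots> \<le> v * norm (x - xh')" using v by (rule mult_right_mono) simp
  finally have "\<eta> * ((g - m) \<bullet> (x - xh')) \<le> (\<eta> * v) * norm (x - xh')"
    using \<eta> by (simp add: mult.assoc)
  also have "\<dots> \<le> ((\<eta> * v)\<^sup>2 + (norm (x - xh'))\<^sup>2) / 2"
    using sum_squares_bound[of "\<eta> * v" "norm (x - xh')"] by (simp add: algebra_simps)
  finally have 3: "\<eta> * ((g - m) \<bullet> (x - xh')) \<le> ((\<eta> * v)\<^sup>2 + (norm (x - xh'))\<^sup>2) / 2" .
  have "\<eta> * (g \<bullet> (x - u)) = \<eta> * (g \<bullet> (xh' - u)) + \<eta> * (m \<bullet> (x - xh')) + \<eta> * ((g - m) \<bullet> (x - xh'))"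
    by (simp add: inner_diff_left inner_diff_right algebra_simps)
  also have "\<dots> \<le> (xh - xh') \<bullet> (xh' - u) + (x - xh) \<bullet> (xh' - x) + ((\<eta> * v)\<^sup>2 + (norm (x - xh'))\<^sup>2) / 2"
    using 1 2 3 by linarith
  also have "\<dots> = ((norm (u - xh))\<^sup>2 - (norm (u - xh'))\<^sup>2 - (norm (x - xh))\<^sup>2) / 2 + (\<eta> * v)\<^sup>2 / 2"
    by (simp add: power2_norm_eq_inner inner_diff_left inner_diff_right inner_commute field_simps)
  also have "\<dots> \<le> ((norm (u - xh))\<^sup>2 - (norm (u - xh'))\<^sup>2) / 2 + (\<eta> * v)\<^sup>2 / 2" by simp
  also have "\<dots> = \<eta> * (((norm (u - xh))\<^sup>2 - (norm (u - xh'))\<^sup>2) / (2 * \<eta>) + \<eta> / 2 * v\<^sup>2)"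
    using \<eta> by (simp add: field_simps power2_eq_square)
  finally show ?thesis using \<eta> by simp
qed

text \<open>For a fixed comparator the sum telescopes. When the comparator moves while
  \<open>z (n + 1)\<close> stays, the mismatch is a difference of squares
  \<open>(a - b) * (a + b)\<close>, at most the length of the move times \<open>2 * D\<close>. The
  negative last term is kept because the induction needs it.\<close>

lemma drifting_comparator_telescope:
  fixes u z :: "nat \<Rightarrow> 'a::euclidean_space"
  assumes diam: "\<And>y z. y \<in> X \<Longrightarrow> z \<in> X \<Longrightarrow> norm (y - z) \<le> D"
    and u: "\<And>t. t \<in> {1..n} \<Longrightarrow> u t \<in> X" and z: "\<And>t. t \<in> {1..n + 1} \<Longrightarrow> z t \<in> X" and "n \<ge> 1"
  shows "(\<Sum>t=1..n. (norm (u t - z t))\<^sup>2 - (norm (u t - z (t + 1)))\<^sup>2)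
    \<le> D\<^sup>2 + 2 * D * (\<Sum>t=2..n. norm (u t - u (t - 1))) - (norm (u n - z (n + 1)))\<^sup>2"
  using \<open>n \<ge> 1\<close> u z
proof (induction n rule: dec_induct)
  case base
  then show ?case using diam[of "u 1" "z 1"] by (simp add: power_mono)
next
  case (step n)
  let ?a = "norm (u (Suc n) - z (Suc n))" and ?b = "norm (u n - z (Suc n))"
    and ?d = "norm (u (Suc n) - u n)"
  have mem: "u (Suc n) \<in> X" "u n \<in> X" "z (Suc n) \<in> X" using step by auto
  have ab: "?a \<le> D" "?b \<le> D" using mem diam by auto
  have "?a - ?b \<le> norm ((u (Suc n) - z (Suc n)) - (u n - z (Suc n)))" by (rule norm_triangle_ineq2)
  also have "\<dots> = ?d" by simp
  finally have "(?a - ?b) * (?a + ?b) \<le> ?d * (?a + ?b)" by (rule mult_right_mono) simp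
  also have "\<dots> \<le> ?d * (2 * D)" using ab by (intro mult_left_mono) auto
  finally have "?a\<^sup>2 - ?b\<^sup>2 \<le> 2 * D * ?d" by (simp add: algebra_simps power2_eq_square)
  moreover have "(\<Sum>t=2..Suc n. norm (u t - u (t - 1))) = (\<Sum>t=2..n. norm (u t - u (t - 1))) + ?d"
    using step.hyps by simp
  moreover have "(\<Sum>t=1..n. (norm (u t - z t))\<^sup>2 - (norm (u t - z (t + 1)))\<^sup>2)
    \<le> D\<^sup>2 + 2 * D * (\<Sum>t=2..n. norm (u t - u (t - 1))) - (norm (u n - z (n + 1)))\<^sup>2"
    using step by auto
  ultimately show ?case by (simp add: distrib_left)
qed

section \<open>Optimistic Hedge with a decreasing learning rate\<close>

text \<open>Hoeffding's lemma for the probability with weights \<open>p\<close>: the values lie in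
  an interval of length \<open>2 * a\<close>, and
  \<open>(2 * a)\<^sup>2 / 8 = a\<^sup>2 / 2\<close>.\<close>

lemma exp_moment_le:
  fixes p \<delta> :: "'i \<Rightarrow> real"
  assumes I: "finite I" and p: "\<And>i. i \<in> I \<Longrightarrow> 0 \<le> p i" "(\<Sum>i\<in>I. p i) = 1"
    and \<delta>: "\<And>i. i \<in> I \<Longrightarrow> \<bar>\<delta> i\<bar> \<le> a"
  shows "(\<Sum>i\<in>I. p i * exp (\<delta> i)) \<le> exp ((\<Sum>i\<in>I. p i * \<delta> i) + a\<^sup>2 / 2)"
proof -
  let ?M = "point_measure I p"
  let ?\<mu> = "\<Sum>i\<in>I. p i * \<delta> i"
  have "emeasure ?M (space ?M) = 1"
    using I p by (simp add: space_point_measure emeasure_point_measure_finite sum_ennreal)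
  then interpret prob_space ?M by (rule prob_spaceI)
  interpret interval_bounded_random_variable ?M \<delta> "- a" a
  proof
    show "\<delta> \<in> borel_measurable ?M" by simp
    show "AE i in ?M. \<delta> i \<in> {- a..a}"
      using \<delta> by (intro AE_I2) (auto simp: space_point_measure abs_le_iff minus_le_iff)
  qed
  have \<mu>: "expectation \<delta> = ?\<mu>"
    using I p by (simp add: lebesgue_integral_point_measure_finite)
  have "ennreal (\<Sum>i\<in>I. p i * exp (\<delta> i - ?\<mu>)) = (\<Sum>i\<in>I. ennreal (exp (\<delta> i - ?\<mu>)) * ennreal (p i))"
    using p by (subst sum_ennreal[symmetric]) (auto simp: ennreal_mult' mult.commute intro!: sum.cong)
  also have "\<dots> = (\<integral>\<^sup>+i. exp (1 * (\<delta> i - expectation \<delta>)) \<partial>?M)"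
    using I p by (simp add: nn_integral_point_measure_finite \<mu> mult.commute)
  also have "\<dots> \<le> ennreal (exp (1\<^sup>2 * (a - (- a))\<^sup>2 / 8))"
    by (rule Hoeffdings_lemma_nn_integral) simp
  finally have "(\<Sum>i\<in>I. p i * exp (\<delta> i - ?\<mu>)) \<le> exp (a\<^sup>2 / 2)"
    by (simp add: power2_eq_square)
  then have "exp ?\<mu> * (\<Sum>i\<in>I. p i * exp (\<delta> i - ?\<mu>)) \<le> exp ?\<mu> * exp (a\<^sup>2 / 2)"
    by (rule mult_left_mono) simp
  then show ?thesis
    by (simp add: sum_distrib_left exp_add exp_diff)
qed

text \<open>Jensen's inequality, from the tangent of \<open>exp\<close> at 0 applied to the centred
  values, whose tangents average to 1.\<close>

lemma exp_moment_ge: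
  fixes p \<delta> :: "'i \<Rightarrow> real"
  assumes p: "\<And>i. i \<in> I \<Longrightarrow> 0 \<le> p i" "(\<Sum>i\<in>I. p i) = 1"
  shows "exp (\<Sum>i\<in>I. p i * \<delta> i) \<le> (\<Sum>i\<in>I. p i * exp (\<delta> i))"
proof -
  let ?\<mu> = "\<Sum>i\<in>I. p i * \<delta> i"
  have "1 = (\<Sum>i\<in>I. p i * (1 + (\<delta> i - ?\<mu>)))"
    using p(2) by (simp add: algebra_simps sum.distrib sum_subtractf flip: sum_distrib_left sum_distrib_right)
  also have "\<dots> \<le> (\<Sum>i\<in>I. p i * exp (\<delta> i - ?\<mu>))"
    using p(1) by (intro sum_mono mult_left_mono exp_ge_add_one_self)
  finally have "exp ?\<mu> * 1 \<le> exp ?\<mu> * (\<Sum>i\<in>I. p i * exp (\<delta> i - ?\<mu>))"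
    by (rule mult_left_mono) simp
  then show ?thesis
    by (simp add: sum_distrib_left exp_diff)
qed

text \<open>A soft minimum of \<open>L\<close>. Dividing by the number of experts makes the argument
  of \<open>ln\<close> a mean, which is what makes the potential vanish at \<open>L = 0\<close> for
  every rate and decrease when the rate grows.\<close>

definition hedge_potential :: "'i set \<Rightarrow> real \<Rightarrow> ('i \<Rightarrow> real) \<Rightarrow> real" where
  "hedge_potential I \<epsilon> L = - ln ((\<Sum>i\<in>I. exp (- \<epsilon> * L i)) / real (card I)) / \<epsilon>"

lemma hedge_potential_zero:
  assumes "finite I" "I \<noteq> {}"
  shows "hedge_potential I \<epsilon> (\<lambda>_. 0) = 0"
  using assms by (simp add: hedge_potential_def)

lemma hedge_potential_le:
  assumes I: "finite I" "i \<in> I" and \<epsilon>: "\<epsilon> > 0"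
  shows "hedge_potential I \<epsilon> L \<le> L i + ln (real (card I)) / \<epsilon>"
proof -
  have c: "card I > 0" using I by (auto simp: card_gt_0_iff)
  have "exp (- \<epsilon> * L i) \<le> (\<Sum>i\<in>I. exp (- \<epsilon> * L i))"
    using I by (intro member_le_sum) auto
  then have "ln (exp (- \<epsilon> * L i) / real (card I)) \<le> ln ((\<Sum>i\<in>I. exp (- \<epsilon> * L i)) / real (card I))"
    using c by (intro ln_mono divide_right_mono) (auto intro!: divide_pos_pos)
  then have "- ln ((\<Sum>i\<in>I. exp (- \<epsilon> * L i)) / real (card I)) / \<epsilon> \<le> (\<epsilon> * L i + ln (real (card I))) / \<epsilon>"
    using c \<epsilon> by (intro divide_right_mono) (auto simp: ln_div)
  then show ?thesis using \<epsilon> by (simp add: hedge_potential_def add_divide_distrib)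
qed

lemma exp_convex_combination:
  fixes y r :: real
  assumes "0 \<le> r" "r \<le> 1"
  shows "exp (r * y) \<le> 1 - r + r * exp y"
proof -
  have "convex_on UNIV (exp :: real \<Rightarrow> real)" by (rule exp_convex)
  from convex_onD[OF this, of r 0 y] assms show ?thesis by simp
qed

text \<open>Monotonicity of power means, with exponent ratio
  \<open>r = \<epsilon>' / \<epsilon>\<close>. Subtracting \<open>ln Z\<close> normalises the
  exponents so that their exponentials have mean 1; averaging the convexity bound for
  \<open>exp (r * y)\<close> then gives at most 1.\<close>

lemma hedge_potential_antimono:
  assumes I: "finite I" "I \<noteq> {}" and \<epsilon>: "0 < \<epsilon>'" "\<epsilon>' \<le> \<epsilon>"
  shows "hedge_potential I \<epsilon> L \<le> hedge_potential I \<epsilon>' L"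
proof -
  define n where "n = real (card I)"
  have n: "n > 0" using I by (auto simp: card_gt_0_iff n_def)
  define Z where "Z = (\<Sum>i\<in>I. exp (- \<epsilon> * L i)) / n"
  define Z' where "Z' = (\<Sum>i\<in>I. exp (- \<epsilon>' * L i)) / n"
  define r where "r = \<epsilon>' / \<epsilon>"
  have r: "0 < r" "r \<le> 1" "r * \<epsilon> = \<epsilon>'" using \<epsilon> by (auto simp: r_def)
  have Z: "Z > 0" and Z': "Z' > 0"
    unfolding Z_def Z'_def using n I by (auto intro!: divide_pos_pos sum_pos)
  have "(\<Sum>i\<in>I. exp (r * (- \<epsilon> * L i - ln Z))) \<le> (\<Sum>i\<in>I. 1 - r + r * exp (- \<epsilon> * L i - ln Z))"
    using r by (intro sum_mono exp_convex_combination) auto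
  also have "\<dots> = (1 - r) * n + r * ((\<Sum>i\<in>I. exp (- \<epsilon> * L i)) / Z)"
    using Z by (simp add: sum.distrib n_def exp_diff sum_distrib_left sum_divide_distrib mult.commute)
  also have "(\<Sum>i\<in>I. exp (- \<epsilon> * L i)) / Z = n"
    using Z n unfolding Z_def by (simp add: field_simps)
  also have "(1 - r) * n + r * n = n" by (simp add: algebra_simps)
  also have "(\<Sum>i\<in>I. exp (r * (- \<epsilon> * L i - ln Z))) = n * Z' / exp (r * ln Z)"
  proof -
    have "r * (- \<epsilon> * L i - ln Z) = - \<epsilon>' * L i - r * ln Z" for i
      using r(3) by (simp add: algebra_simps flip: mult.assoc)
    then show ?thesis using n by (simp add: exp_diff Z'_def flip: sum_divide_distrib)
  qed
  finally have "Z' \<le> exp (r * ln Z)" using n by (simp add: divide_le_eq)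
  then have "ln Z' \<le> ln (exp (r * ln Z))" using Z' by (intro ln_mono) auto
  then have "ln Z' \<le> r * ln Z" by simp
  then have "- (r * ln Z) / \<epsilon>' \<le> - ln Z' / \<epsilon>'" using \<epsilon> by (intro divide_right_mono) auto
  moreover have "- (r * ln Z) / \<epsilon>' = - ln Z / \<epsilon>" using \<epsilon> by (simp add: r_def)
  ultimately show ?thesis by (simp add: hedge_potential_def Z_def Z'_def n_def)
qed

text \<open>
  The weights \<open>p\<close> are the exponential weights of the guess \<open>L + m\<close>: the passage from \<open>L\<close> to
  \<open>L + m\<close>, seen backwards from \<open>p\<close>, costs nothing by Jensen's inequality, and Hoeffding's lemma
  bounds the passage from \<open>L + m\<close> to \<open>L + l\<close>.
\<close>

lemma hedge_step:
  fixes L l m p :: "'i \<Rightarrow> real"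
  assumes I: "finite I" "I \<noteq> {}" and \<epsilon>: "\<epsilon> > 0"
    and p: "\<And>i. i \<in> I \<Longrightarrow> p i = exp (- \<epsilon> * (L i + m i)) / (\<Sum>j\<in>I. exp (- \<epsilon> * (L j + m j)))"
    and a: "\<And>i. i \<in> I \<Longrightarrow> \<bar>l i - m i\<bar> \<le> a"
  shows "(\<Sum>i\<in>I. p i * l i)
    \<le> hedge_potential I \<epsilon> (\<lambda>i. L i + l i) - hedge_potential I \<epsilon> L + \<epsilon> * a\<^sup>2 / 2"
proof -
  define S where "S = (\<Sum>j\<in>I. exp (- \<epsilon> * (L j + m j)))"
  define n where "n = real (card I)"
  have n: "n > 0" using I by (auto simp: card_gt_0_iff n_def)
  have S: "S > 0" unfolding S_def using I by (intro sum_pos) auto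
  have p': "p i = exp (- \<epsilon> * (L i + m i)) / S" if "i \<in> I" for i using p[OF that] by (simp add: S_def)
  have p0: "0 \<le> p i" if "i \<in> I" for i using p'[OF that] S by simp
  have p1: "(\<Sum>i\<in>I. p i) = 1"
    using S by (simp add: p' sum_divide_distrib[symmetric]) (simp add: S_def)
  let ?Q = "\<lambda>K. \<Sum>i\<in>I. exp (- \<epsilon> * K i)"
  have Q: "?Q K > 0" for K :: "'i \<Rightarrow> real" using I by (intro sum_pos) auto
  have "?Q (\<lambda>i. L i + l i) / S = (\<Sum>i\<in>I. p i * exp (- \<epsilon> * (l i - m i)))"
    by (simp add: sum_divide_distrib p' exp_add[symmetric] algebra_simps)
  also have "\<dots> \<le> exp ((\<Sum>i\<in>I. p i * (- \<epsilon> * (l i - m i))) + (\<epsilon> * a)\<^sup>2 / 2)"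
    using I p0 p1 a \<epsilon> by (intro exp_moment_le) (auto simp: abs_mult)
  finally have "ln (?Q (\<lambda>i. L i + l i) / S) \<le> ln (exp ((\<Sum>i\<in>I. p i * (- \<epsilon> * (l i - m i))) + (\<epsilon> * a)\<^sup>2 / 2))"
    using S Q by (intro ln_mono divide_pos_pos)
  then have up: "ln (?Q (\<lambda>i. L i + l i)) - ln S \<le> - \<epsilon> * (\<Sum>i\<in>I. p i * (l i - m i)) + (\<epsilon> * a)\<^sup>2 / 2"
    using S Q[of "\<lambda>i. L i + l i"] by (simp add: ln_div sum_distrib_left mult_ac sum_negf)
  have "exp (\<Sum>i\<in>I. p i * (\<epsilon> * m i)) \<le> (\<Sum>i\<in>I. p i * exp (\<epsilon> * m i))"
    using p0 p1 by (rule exp_moment_ge)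
  also have "\<dots> = ?Q L / S"
    by (simp add: sum_divide_distrib p' exp_add[symmetric] algebra_simps)
  finally have "(\<Sum>i\<in>I. p i * (\<epsilon> * m i)) \<le> ln (?Q L / S)"
    using S Q by (simp add: ln_ge_iff)
  then have down: "\<epsilon> * (\<Sum>i\<in>I. p i * m i) \<le> ln (?Q L) - ln S"
    using S Q[of L] by (simp add: ln_div sum_distrib_left mult_ac)
  have "\<epsilon> * (\<Sum>i\<in>I. p i * l i) = \<epsilon> * (\<Sum>i\<in>I. p i * (l i - m i)) + \<epsilon> * (\<Sum>i\<in>I. p i * m i)"
    by (simp add: algebra_simps sum_subtractf)
  also have "\<dots> \<le> ln (?Q L) - ln (?Q (\<lambda>i. L i + l i)) + (\<epsilon> * a)\<^sup>2 / 2"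
    using up down by linarith
  also have "\<dots> = \<epsilon> * (hedge_potential I \<epsilon> (\<lambda>i. L i + l i) - hedge_potential I \<epsilon> L + \<epsilon> * a\<^sup>2 / 2)"
    using \<epsilon> n Q[of L] Q[of "\<lambda>i. L i + l i"]
    by (simp add: hedge_potential_def ln_div n_def[symmetric] field_simps power2_eq_square)
  finally show ?thesis using \<epsilon> by simp
qed

text \<open>The one-step bounds telescope. Lowering the rate from \<open>\<epsilon> n\<close> to
  \<open>\<epsilon> (Suc n)\<close> only increases the potential, so an adaptive rate costs nothing
  extra. Round \<open>t\<close> uses the rate \<open>\<epsilon> (t - 1)\<close>, known before
  \<open>f t\<close> is revealed.\<close>

lemma hedge_regret:
  fixes l m p :: "nat \<Rightarrow> 'i \<Rightarrow> real" and \<epsilon> a :: "nat \<Rightarrow> real"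
  assumes I: "finite I" "i \<in> I" and \<epsilon>: "\<And>t. \<epsilon> t > 0" "\<And>t. \<epsilon> (Suc t) \<le> \<epsilon> t"
    and p: "\<And>t j. t \<in> {1..T} \<Longrightarrow> j \<in> I \<Longrightarrow>
      p t j = exp (- \<epsilon> (t - 1) * ((\<Sum>s=1..t-1. l s j) + m t j))
        / (\<Sum>k\<in>I. exp (- \<epsilon> (t - 1) * ((\<Sum>s=1..t-1. l s k) + m t k)))"
    and a: "\<And>t j. t \<in> {1..T} \<Longrightarrow> j \<in> I \<Longrightarrow> \<bar>l t j - m t j\<bar> \<le> a t"
  shows "(\<Sum>t=1..T. \<Sum>j\<in>I. p t j * l t j)
    \<le> (\<Sum>t=1..T. l t i) + ln (real (card I)) / \<epsilon> T + (\<Sum>t=1..T. \<epsilon> (t - 1) * (a t)\<^sup>2 / 2)"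
proof -
  have I': "I \<noteq> {}" using I by auto
  have "(\<Sum>t=1..n. \<Sum>j\<in>I. p t j * l t j)
    \<le> hedge_potential I (\<epsilon> n) (\<lambda>j. \<Sum>s=1..n. l s j) + (\<Sum>t=1..n. \<epsilon> (t - 1) * (a t)\<^sup>2 / 2)"
    if "n \<le> T" for n
    using that
  proof (induction n)
    case 0
    then show ?case using I I' by (simp add: hedge_potential_zero)
  next
    case (Suc n)
    let ?L = "\<lambda>n j. \<Sum>s=1..n. l s j"
    have "(\<Sum>j\<in>I. p (Suc n) j * l (Suc n) j) \<le> hedge_potential I (\<epsilon> n) (\<lambda>j. ?L n j + l (Suc n) j)
        - hedge_potential I (\<epsilon> n) (?L n) + \<epsilon> n * (a (Suc n))\<^sup>2 / 2"
      using I I' \<epsilon> p[of "Suc n"] a[of "Suc n"] Suc.prems by (intro hedge_step[where m = "m (Suc n)"]) auto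
    also have "(\<lambda>j. ?L n j + l (Suc n) j) = ?L (Suc n)" by simp
    also have "hedge_potential I (\<epsilon> n) (?L (Suc n)) \<le> hedge_potential I (\<epsilon> (Suc n)) (?L (Suc n))"
      using I I' \<epsilon> by (intro hedge_potential_antimono) auto
    finally show ?case using Suc by simp
  qed
  from this[of T] hedge_potential_le[OF I \<epsilon>(1), of T "\<lambda>j. \<Sum>s=1..T. l s j"]
  show ?thesis by simp
qed

text \<open>Let \<open>x\<close> and \<open>y\<close> be the roots before and after adding
  \<open>b\<^sup>2\<close>. Then \<open>b\<^sup>2 / (2 * x) = (y - x) * (y + x) / (2 * x)\<close>, a
  telescoping increment times a ratio. The rate lags one round behind, so the ratio is controlled by
  \<open>y \<le> x * (1 + B)\<close>, which holds as the 1 under the root forces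
  \<open>x \<ge> 1\<close>.\<close>

lemma adaptive_rate_sum:
  fixes a :: "nat \<Rightarrow> real"
  assumes B: "B \<ge> 0" and a: "\<And>t. t \<in> {1..n} \<Longrightarrow> \<bar>a t\<bar> \<le> B"
  shows "(\<Sum>t=1..n. 1 / sqrt (1 + (\<Sum>s=1..t-1. (a s)\<^sup>2)) * (a t)\<^sup>2 / 2)
    \<le> (1 + B) * sqrt (1 + (\<Sum>s=1..n. (a s)\<^sup>2))"
  using a
proof (induction n)
  case 0
  then show ?case using B by simp
next
  case (Suc n)
  define x where "x = sqrt (1 + (\<Sum>s=1..n. (a s)\<^sup>2))"
  define y where "y = sqrt (1 + (\<Sum>s=1..Suc n. (a s)\<^sup>2))"
  define b where "b = a (Suc n)"
  have x1: "x \<ge> 1" by (simp add: x_def sum_nonneg)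
  have x2: "x\<^sup>2 = 1 + (\<Sum>s=1..n. (a s)\<^sup>2)" by (simp add: x_def sum_nonneg add_nonneg_nonneg)
  have y2: "y\<^sup>2 = x\<^sup>2 + b\<^sup>2"
    unfolding x2 by (simp add: y_def b_def sum_nonneg add_nonneg_nonneg)
  have y0: "y \<ge> 0" by (simp add: y_def sum_nonneg add_nonneg_nonneg)
  have xy: "x \<le> y" using y2 y0 by (intro power2_le_imp_le[of x y]) auto
  have b: "\<bar>b\<bar> \<le> B" using Suc.prems by (simp add: b_def)
  have "y\<^sup>2 \<le> (x * (1 + B))\<^sup>2"
  proof -
    have "b\<^sup>2 \<le> B\<^sup>2" using b by (metis abs_le_square_iff abs_of_nonneg B)
    also have "\<dots> \<le> x\<^sup>2 * B\<^sup>2" using x1 by (simp add: mult_left_le_imp_le mult_le_cancel_right1)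
    finally have "y\<^sup>2 \<le> x\<^sup>2 * (1 + B\<^sup>2)" by (simp add: y2 algebra_simps)
    also have "\<dots> \<le> x\<^sup>2 * (1 + B)\<^sup>2" using B by (intro mult_left_mono) (auto simp: power2_sum)
    finally show ?thesis by (simp add: power_mult_distrib)
  qed
  then have yx: "y \<le> x * (1 + B)" using x1 B by (intro power2_le_imp_le[of y]) auto
  have "1 / x * b\<^sup>2 / 2 = (y - x) * (y + x) / (2 * x)"
    using y2 x1 by (simp add: algebra_simps power2_eq_square)
  also have "\<dots> \<le> (y - x) * (2 * (x * (1 + B))) / (2 * x)"
    using xy yx x1 B by (intro divide_right_mono mult_left_mono) auto
  also have "\<dots> = (1 + B) * y - (1 + B) * x" using x1 by (simp add: field_simps)
  finally have "1 / x * b\<^sup>2 / 2 \<le> (1 + B) * y - (1 + B) * x" .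
  then show ?case using Suc.IH Suc.prems unfolding x_def y_def b_def by auto
qed

section \<open>Regret of the two-layer algorithm along a fixed path\<close>

text \<open>The guess for round \<open>t\<close>. The value of \<open>f\<close> at index 0 is
  arbitrary, so the convention of a zero loss before round 1 is built in here.\<close>

definition previous_loss :: "(nat \<Rightarrow> 'a \<Rightarrow> real) \<Rightarrow> nat \<Rightarrow> 'a \<Rightarrow> real" where
  "previous_loss f t = (if t \<le> 1 then (\<lambda>_. 0) else f (t - 1))"

lemma ratio_shift:
  fixes e :: "'i \<Rightarrow> real"
  assumes "c \<noteq> 0"
  shows "e j * c / (\<Sum>k\<in>I. e k * c) = e j / (\<Sum>k\<in>I. e k)"
  using assms by (simp flip: sum_distrib_right)

text \<open>The regret is split at the iterates of an arbitrary base-learner \<open>i\<close>: the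
  meta-learner competes with \<open>i\<close>, and \<open>i\<close> competes with the path
  \<open>u\<close>. The index stays free so that it can be chosen later from expectations.
  \<open>K\<close> enters only through the lag of the meta rate.\<close>

lemma two_layer_regret:
  fixes X :: "'a::euclidean_space set" and f :: "nat \<Rightarrow> 'a \<Rightarrow> real"
  assumes T: "T \<ge> 1" and X: "closed X" "convex X"
    and diam: "\<And>y z. y \<in> X \<Longrightarrow> z \<in> X \<Longrightarrow> norm (y - z) \<le> D"
    and diff: "\<And>t. t \<in> {1..T} \<Longrightarrow> f t differentiable_on X"
    and conv: "\<And>t. t \<in> {1..T} \<Longrightarrow> convex_on X (f t)"
    and v: "\<And>t. t \<in> {1..T} \<Longrightarrow> lipschitz_bound X (v t) (\<lambda>y. f t y - previous_loss f t y)"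
    and v0: "\<And>t. t \<in> {1..T} \<Longrightarrow> 0 \<le> v t" and vK: "\<And>t. t \<in> {1..T} \<Longrightarrow> v t \<le> K"
    and start: "\<And>j. j \<in> {1..N} \<Longrightarrow> start j \<in> X" and ref: "x_ref \<in> X"
    and \<eta>: "\<And>j. j \<in> {1..N} \<Longrightarrow> \<eta> j > 0"
    and run: "two_layer_run X T N \<eta> x_ref start f xh x p play"
    and u: "\<And>t. t \<in> {1..T} \<Longrightarrow> u t \<in> X" and i: "i \<in> {1..N}"
  shows "(\<Sum>t=1..T. f t (play t)) - (\<Sum>t=1..T. f t (u t))
    \<le> (ln (real N) + 1 + K * D) * sqrt (1 + D\<^sup>2 * (\<Sum>t=1..T. (v t)\<^sup>2))
      + (D\<^sup>2 + 2 * D * (\<Sum>t=2..T. norm (u t - u (t - 1)))) / (2 * \<eta> i)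
      + \<eta> i / 2 * (\<Sum>t=1..T. (v t)\<^sup>2)"
proof -
  have D0: "D \<ge> 0" using diam[OF ref ref] by simp
  have K0: "K \<ge> 0" using v0[of 1] vK[of 1] T by simp
  have N: "N \<ge> 1" using i by auto
  have init: "x 1 j = start j" "xh 1 j = start j" "p 1 j = 1 / real N" if "j \<in> {1..N}" for j
    using run that by (auto simp: two_layer_run_def)
  have step: "xh (t + 1) j = closest_point X (xh t j - \<eta> j *\<^sub>R gradient_on X (f t) (x t j))"
    "is_arg_min (\<lambda>y. f t y + 1 / (2 * \<eta> j) * (norm (y - xh (t + 1) j))\<^sup>2) (\<lambda>y. y \<in> X) (x (t + 1) j)"
    "p (t + 1) j = meta_weight N f x_ref x t j / (\<Sum>k=1..N. meta_weight N f x_ref x t k)"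
    if "t \<in> {1..T}" "j \<in> {1..N}" for t j
    using run that unfolding two_layer_run_def by blast+
  have play: "play t = (\<Sum>j=1..N. p t j *\<^sub>R x t j)" if "t \<in> {1..T}" for t
    using run that by (auto simp: two_layer_run_def)
  \<comment> \<open>The run produces iterates up to index \<open>T + 1\<close>; each is either
    initial or the output of a round.\<close>
  have round_cases: "t = 1 \<or> (\<exists>s\<in>{1..T}. t = s + 1)" if "t \<in> {1..T + 1}" for t
    using that by (cases t) auto
  have xX: "x t j \<in> X" and xhX: "xh t j \<in> X" if "t \<in> {1..T + 1}" "j \<in> {1..N}" for t j
  proof -
    show "x t j \<in> X"
      using round_cases[OF that(1)] init start step(2) that(2) unfolding is_arg_min_def by metis
    show "xh t j \<in> X"
      using round_cases[OF that(1)] init start step(1) that(2) closest_point_in_set[OF X(1)] ref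
      by (metis empty_iff)
  qed

  \<comment> \<open>Regret of base-learner \<open>i\<close> against the path
    \<open>u\<close>\<close>
  have base: "f t (x t i) - f t (u t)
      \<le> ((norm (u t - xh t i))\<^sup>2 - (norm (u t - xh (t + 1) i))\<^sup>2) / (2 * \<eta> i) + \<eta> i / 2 * (v t)\<^sup>2"
    if t: "t \<in> {1..T}" for t
  proof -
    have xt: "x t i \<in> X" using xX t i by auto
    have pd: "previous_loss f t differentiable_on X"
    proof (cases "t \<le> 1")
      case False
      then have "t - 1 \<in> {1..T}" using t by auto
      from diff[OF this] show ?thesis using False by (simp add: previous_loss_def)
    qed (simp add: previous_loss_def)
    let ?g = "gradient_on X (f t) (x t i)" and ?m = "gradient_on X (previous_loss f t) (x t i)"
    have "f t (x t i) - f t (u t) \<le> ?g \<bullet> (x t i - u t)"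
      using convex_gradient_ineq[OF conv diff xt u, of t t] t
      by (simp add: inner_diff_right algebra_simps)
    also have "\<dots> \<le> ((norm (u t - xh t i))\<^sup>2 - (norm (u t - xh (t + 1) i))\<^sup>2) / (2 * \<eta> i) + \<eta> i / 2 * (v t)\<^sup>2"
    proof (rule optimistic_mirror_step[OF X(2,1) \<eta>[OF i] u[OF t] step(1)[OF t i]])
      fix y assume y: "y \<in> X"
      from round_cases[of t] t consider "t = 1" | s where "s \<in> {1..T}" "t = s + 1" by auto
      then show "0 \<le> ?m \<bullet> (y - x t i) + (x t i - xh t i) \<bullet> (y - x t i) / \<eta> i"
      proof cases
        \<comment> \<open>No update precedes round 1: the guess is zero and
          \<open>x 1 i = xh 1 i\<close>, so both terms vanish.\<close>
        case 1
        then show ?thesis using init[OF i] X(2) xt by (simp add: previous_loss_def)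
      next
        case 2
        then have "previous_loss f t = f s" by (simp add: previous_loss_def)
        then show ?thesis
          using proximal_optimality[OF X(2) diff \<eta>[OF i] y step(2)[OF _ i]] 2 by auto
      qed
    next
      have "?g - ?m = gradient_on X (\<lambda>y. f t y - previous_loss f t y) (x t i)"
        using gradient_on_diff[OF X(2) xt diff[OF t] pd] by simp
      then show "norm (?g - ?m) \<le> v t"
        using gradient_norm_le[OF X(2) xt _ v[OF t] v0[OF t]] diff[OF t] pd
        by (simp add: differentiable_on_diff)
    qed
    finally show ?thesis .
  qed
  have base_regret: "(\<Sum>t=1..T. f t (x t i) - f t (u t))
    \<le> (D\<^sup>2 + 2 * D * (\<Sum>t=2..T. norm (u t - u (t - 1)))) / (2 * \<eta> i) + \<eta> i / 2 * (\<Sum>t=1..T. (v t)\<^sup>2)"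
  proof -
    have "(\<Sum>t=1..T. f t (x t i) - f t (u t))
      \<le> (\<Sum>t=1..T. (norm (u t - xh t i))\<^sup>2 - (norm (u t - xh (t + 1) i))\<^sup>2) / (2 * \<eta> i)
        + \<eta> i / 2 * (\<Sum>t=1..T. (v t)\<^sup>2)"
      unfolding sum_divide_distrib sum_distrib_left sum.distrib[symmetric]
      by (intro sum_mono base)
    also have "(\<Sum>t=1..T. (norm (u t - xh t i))\<^sup>2 - (norm (u t - xh (t + 1) i))\<^sup>2)
      \<le> D\<^sup>2 + 2 * D * (\<Sum>t=2..T. norm (u t - u (t - 1))) - (norm (u T - xh (T + 1) i))\<^sup>2"
      by (rule drifting_comparator_telescope[where X = X]) (use diam u xhX i T in auto)
    also have "\<dots> \<le> D\<^sup>2 + 2 * D * (\<Sum>t=2..T. norm (u t - u (t - 1)))" by simp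
    finally show ?thesis using \<eta>[OF i] by (simp add: divide_right_mono)
  qed

  \<comment> \<open>Regret of the meta-learner against base-learner \<open>i\<close>\<close>
  define l where "l t j = shifted_loss f x_ref t (x t j)" for t j
  define m where "m t j = shifted_loss f x_ref (t - 1) (x t j)" for t j
  define a where "a t = (MAX j\<in>{1..N}. \<bar>l t j - m t j\<bar>)" for t
  define \<epsilon> where "\<epsilon> t = meta_rate N f x_ref x t" for t
  have \<epsilon>_eq: "\<epsilon> t = 1 / sqrt (1 + (\<Sum>s=1..t. (a s)\<^sup>2))" for t
    by (simp add: \<epsilon>_def meta_rate_def a_def l_def m_def)
  have \<epsilon>0: "\<epsilon> t > 0" for t
    unfolding \<epsilon>_eq by (intro divide_pos_pos real_sqrt_gt_zero add_pos_nonneg sum_nonneg) auto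
  have \<epsilon>mono: "\<epsilon> (Suc t) \<le> \<epsilon> t" for t
    unfolding \<epsilon>_eq
    by (intro divide_left_mono real_sqrt_le_mono mult_pos_pos real_sqrt_gt_zero add_pos_nonneg sum_nonneg) auto
  have a_ge: "\<bar>l t j - m t j\<bar> \<le> a t" if "j \<in> {1..N}" for t j
    unfolding a_def using that by (intro Max_ge) auto
  have a_le: "a t \<le> v t * D" if t: "t \<in> {1..T}" for t
    unfolding a_def
  proof (rule Max.boundedI)
    fix b assume "b \<in> (\<lambda>j. \<bar>l t j - m t j\<bar>) ` {1..N}"
    then obtain j where j: "j \<in> {1..N}" and b: "b = \<bar>l t j - m t j\<bar>" by auto
    have xt: "x t j \<in> X" using xX t j by auto
    \<comment> \<open>Subtracting the value at \<open>x_ref\<close> turns a difference of loss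
      values, which no gradient bound controls, into an increment of \<open>f t - f (t - 1)\<close>
      between two points of \<open>X\<close>.\<close>
    have "l t j - m t j = (f t (x t j) - previous_loss f t (x t j)) - (f t x_ref - previous_loss f t x_ref)"
      using t by (auto simp: l_def m_def shifted_loss_def previous_loss_def)
    then have "b \<le> v t * norm (x t j - x_ref)"
      using lipschitz_boundD[OF v[OF t] xt ref] b by simp
    also have "\<dots> \<le> v t * D" using diam[OF xt ref] v0[OF t] by (rule mult_left_mono)
    finally show "b \<le> v t * D" .
  qed (use N in auto)
  have a0: "0 \<le> a t" for t using a_ge[OF i, of t] by linarith
  have weights: "p t j = exp (- \<epsilon> (t - 1) * ((\<Sum>s=1..t-1. l s j) + m t j))
      / (\<Sum>k=1..N. exp (- \<epsilon> (t - 1) * ((\<Sum>s=1..t-1. l s k) + m t k)))"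
    if t: "t \<in> {1..T}" and j: "j \<in> {1..N}" for t j
  proof -
    from round_cases[of t] t consider "t = 1" | s where "s \<in> {1..T}" "t = s + 1" by auto
    then show ?thesis
    proof cases
      case 1
      then show ?thesis using init(3)[OF j] by (simp add: m_def shifted_loss_def)
    next
      case 2
      \<comment> \<open>The algorithm weighs by unshifted losses. The shifts do not depend on the
        learner, so they contribute one common factor that cancels after normalisation; the last
        summand is the shift of the guess.\<close>
      define c where "c = exp (- \<epsilon> s * ((\<Sum>r=1..s. f r x_ref) + f s x_ref))"
      let ?e = "\<lambda>k. exp (- \<epsilon> s * ((\<Sum>r=1..s. l r k) + m t k))"
      have weight: "meta_weight N f x_ref x s k = ?e k * c" for k
      proof -
        have l_sum: "(\<Sum>r=1..s. l r k) = (\<Sum>r=1..s. f r (x r k)) - (\<Sum>r=1..s. f r x_ref)"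
          unfolding sum_subtractf[symmetric]
          by (intro sum.cong) (auto simp: l_def shifted_loss_def)
        have m_eq: "m t k = f s (x (s + 1) k) - f s x_ref"
          using 2 by (simp add: m_def shifted_loss_def)
        show ?thesis
          unfolding meta_weight_def c_def \<epsilon>_def[symmetric] exp_add[symmetric] l_sum m_eq
          by (simp add: algebra_simps)
      qed
      have "p t j = ?e j * c / (\<Sum>k=1..N. ?e k * c)"
        using step(3)[OF 2(1) j] 2(2) by (simp only: weight)
      also have "\<dots> = ?e j / (\<Sum>k=1..N. ?e k)"
        by (rule ratio_shift) (simp add: c_def)
      finally show ?thesis using 2(2) by simp
    qed
  qed
  have p0: "0 \<le> p t j" if "t \<in> {1..T}" "j \<in> {1..N}" for t j
    unfolding weights[OF that] by (intro divide_nonneg_nonneg sum_nonneg) auto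
  have p1: "(\<Sum>j=1..N. p t j) = 1" if "t \<in> {1..T}" for t
  proof -
    let ?e = "\<lambda>k. exp (- \<epsilon> (t - 1) * ((\<Sum>s=1..t-1. l s k) + m t k))"
    have "(\<Sum>k=1..N. ?e k) > 0" using N by (intro sum_pos) auto
    moreover have "(\<Sum>j=1..N. p t j) = (\<Sum>j=1..N. ?e j) / (\<Sum>k=1..N. ?e k)"
      unfolding sum_divide_distrib using weights[OF that] by (intro sum.cong) auto
    ultimately show ?thesis by simp
  qed
  have jensen: "f t (play t) - f t x_ref \<le> (\<Sum>j=1..N. p t j * l t j)" if t: "t \<in> {1..T}" for t
  proof -
    have "f t (play t) \<le> (\<Sum>j=1..N. p t j * f t (x t j))"
      unfolding play[OF t] using N p0[OF t] p1[OF t] xX t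
      by (intro convex_on_sum[OF _ _ conv[OF t]]) auto
    moreover have "(\<Sum>j=1..N. p t j * l t j) = (\<Sum>j=1..N. p t j * f t (x t j)) - (\<Sum>j=1..N. p t j) * f t x_ref"
      using t by (simp add: l_def shifted_loss_def right_diff_distrib sum_subtractf sum_distrib_right)
    ultimately show ?thesis using p1[OF t] by simp
  qed
  define A where "A = sqrt (1 + (\<Sum>s=1..T. (a s)\<^sup>2))"
  define S where "S = sqrt (1 + D\<^sup>2 * (\<Sum>t=1..T. (v t)\<^sup>2))"
  \<comment> \<open>The realised rate depends on the iterates. It is replaced by a quantity built
    from \<open>v\<close> alone, whose measurability can be established.\<close>
  have AS: "A \<le> S"
    unfolding A_def S_def sum_distrib_left power_mult_distrib[symmetric]
    using a_le a0 by (intro real_sqrt_le_mono add_left_mono sum_mono power_mono) (auto simp: mult.commute)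
  have rate: "(\<Sum>t=1..T. \<epsilon> (t - 1) * (a t)\<^sup>2 / 2) \<le> (1 + K * D) * A"
    unfolding \<epsilon>_eq A_def
  proof (rule adaptive_rate_sum)
    fix t assume t: "t \<in> {1..T}"
    have "a t \<le> v t * D" by (rule a_le[OF t])
    also have "\<dots> \<le> K * D" using vK[OF t] D0 by (rule mult_right_mono)
    finally show "\<bar>a t\<bar> \<le> K * D" using a0 by simp
  qed (use K0 D0 in simp)
  have "(\<Sum>t=1..T. f t (play t) - f t x_ref) \<le> (\<Sum>t=1..T. \<Sum>j=1..N. p t j * l t j)"
    by (intro sum_mono jensen)
  also have "\<dots> \<le> (\<Sum>t=1..T. l t i) + ln (real (card {1..N})) / \<epsilon> T + (\<Sum>t=1..T. \<epsilon> (t - 1) * (a t)\<^sup>2 / 2)"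
    using i \<epsilon>0 \<epsilon>mono weights a_ge by (intro hedge_regret[where m = m]) auto
  also have "\<dots> \<le> (\<Sum>t=1..T. l t i) + ln (real N) * A + (1 + K * D) * A"
    using rate by (simp add: \<epsilon>_eq A_def)
  also have "(\<Sum>t=1..T. l t i) = (\<Sum>t=1..T. f t (x t i) - f t x_ref)"
    by (intro sum.cong) (auto simp: l_def shifted_loss_def)
  finally have "(\<Sum>t=1..T. f t (play t)) - (\<Sum>t=1..T. f t (x t i)) \<le> (ln (real N) + 1 + K * D) * A"
    by (simp add: sum_subtractf algebra_simps)
  also have "\<dots> \<le> (ln (real N) + 1 + K * D) * S"
    using AS N K0 D0 by (intro mult_left_mono) auto
  finally show ?thesis using base_regret by (simp add: S_def sum_subtractf)
qed

section \<open>The Lipschitz seminorm over a countable dense set\<close>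

text \<open>Values in \<open>ennreal\<close> admit functions that are not Lipschitz, and a countable
  \<open>C\<close> makes the suprema measurable. Pairs with \<open>y = z\<close> contribute 0, since
  division by zero gives 0.\<close>

definition lip_norm :: "'a::euclidean_space set \<Rightarrow> ('a \<Rightarrow> real) \<Rightarrow> ennreal" where
  "lip_norm C h = (SUP y\<in>C. SUP z\<in>C. ennreal (\<bar>h y - h z\<bar> / norm (y - z)))"

lemma lip_norm_leI:
  assumes "\<And>y z. y \<in> C \<Longrightarrow> z \<in> C \<Longrightarrow> \<bar>h y - h z\<bar> \<le> L * norm (y - z)" and "L \<ge> 0"
  shows "lip_norm C h \<le> ennreal L"
  unfolding lip_norm_def
proof (intro SUP_least ennreal_leI)
  fix y z assume "y \<in> C" "z \<in> C"
  then show "\<bar>h y - h z\<bar> / norm (y - z) \<le> L"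
    using assms(1)[of y z] assms(2) by (cases "y = z") (simp_all add: divide_le_eq)
qed

text \<open>The nontrivial direction passes to the limit along sequences in \<open>C\<close>, using
  density and the continuity of \<open>h\<close>.\<close>

lemma lip_norm_le_iff:
  assumes C: "C \<subseteq> X" "X \<subseteq> closure C" and h: "continuous_on X h" and L: "L \<ge> 0"
  shows "lip_norm C h \<le> ennreal L \<longleftrightarrow> lipschitz_bound X L h"
proof
  assume "lipschitz_bound X L h"
  then show "lip_norm C h \<le> ennreal L"
    using C(1) L by (intro lip_norm_leI) (auto dest: lipschitz_boundD)
next
  assume le: "lip_norm C h \<le> ennreal L"
  have onC: "\<bar>h y - h z\<bar> \<le> L * norm (y - z)" if yz: "y \<in> C" "z \<in> C" for y z
  proof -
    have "ennreal (\<bar>h y - h z\<bar> / norm (y - z)) \<le> lip_norm C h"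
      unfolding lip_norm_def using yz by (meson SUP_upper order_trans)
    with le have "ennreal (\<bar>h y - h z\<bar> / norm (y - z)) \<le> ennreal L" by (rule order_trans[rotated])
    then show ?thesis using L by (cases "y = z") (simp_all add: divide_le_eq)
  qed
  show "lipschitz_bound X L h"
    unfolding lipschitz_bound_def
  proof (intro ballI)
    fix y z assume yz: "y \<in> X" "z \<in> X"
    then obtain s r where s: "\<And>n. s n \<in> C" "s \<longlonglongrightarrow> y" and r: "\<And>n. r n \<in> C" "r \<longlonglongrightarrow> z"
      using C(2) by (metis closure_sequential subsetD)
    have "(\<lambda>n. h (s n)) \<longlonglongrightarrow> h y"
      by (rule continuous_on_tendsto_compose[OF h s(2) yz(1)]) (intro always_eventually allI subsetD[OF C(1)] s(1))
    moreover have "(\<lambda>n. h (r n)) \<longlonglongrightarrow> h z"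
      by (rule continuous_on_tendsto_compose[OF h r(2) yz(2)]) (intro always_eventually allI subsetD[OF C(1)] r(1))
    ultimately have "(\<lambda>n. \<bar>h (s n) - h (r n)\<bar>) \<longlonglongrightarrow> \<bar>h y - h z\<bar>"
      by (auto intro!: tendsto_intros)
    moreover have "(\<lambda>n. L * norm (s n - r n)) \<longlonglongrightarrow> L * norm (y - z)"
      by (intro tendsto_intros s(2) r(2))
    ultimately show "\<bar>h y - h z\<bar> \<le> L * norm (y - z)"
      using onC s r by (intro LIMSEQ_le) auto
  qed
qed

lemma lip_norm_lipschitz_bound:
  assumes "C \<subseteq> X" "X \<subseteq> closure C" "continuous_on X h" "lip_norm C h \<noteq> \<top>"
  shows "lipschitz_bound X (enn2real (lip_norm C h)) h"
  using lip_norm_le_iff[OF assms(1-3), of "enn2real (lip_norm C h)"] assms(4)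
  by (simp add: less_top)

lemma lip_norm_measurable:
  assumes "countable C" and "\<And>y. y \<in> C \<Longrightarrow> (\<lambda>w. h w y) \<in> borel_measurable N"
  shows "(\<lambda>w. lip_norm C (h w)) \<in> borel_measurable N"
  unfolding lip_norm_def
  by (intro borel_measurable_SUP measurable_compose[OF _ measurable_ennreal]
      borel_measurable_divide borel_measurable_abs borel_measurable_diff borel_measurable_const assms)

text \<open>
  The supremum of an unbounded set of reals is the arbitrary value \<open>LEAST z. False\<close>, which is
  also \<open>Sup UNIV\<close>.
\<close>

definition lip_sq :: "'a::euclidean_space set \<Rightarrow> ('a \<Rightarrow> real) \<Rightarrow> real" where
  "lip_sq C h = (if lip_norm C h = \<top> then Sup UNIV else (enn2real (lip_norm C h))\<^sup>2)"

lemma Sup_unbounded_real: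
  fixes S :: "real set"
  assumes "\<not> bdd_above S"
  shows "Sup S = Sup UNIV"
proof -
  have "(\<forall>x\<in>S. x \<le> z) \<longleftrightarrow> (\<forall>x\<in>(UNIV::real set). x \<le> z)" for z
  proof -
    have "\<not> (\<forall>x\<in>S. x \<le> z)" using assms by (auto simp: bdd_above_def)
    moreover have "\<not> (\<forall>x\<in>(UNIV::real set). x \<le> z)" by (metis UNIV_I gt_ex not_le)
    ultimately show ?thesis by blast
  qed
  then show ?thesis by (simp add: Sup_real_def)
qed

text \<open>The mean value inequality gives one estimate, \<open>gradient_norm_le\<close> the other.
  The unbounded case is included so that the identity holds for every differentiable
  \<open>h\<close>, which yields measurability without discarding null sets.\<close>

lemma SUP_gradient_sq:
  fixes h :: "'a::euclidean_space \<Rightarrow> real"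
  assumes X: "convex X" "X \<noteq> {}" and C: "C \<subseteq> X" "X \<subseteq> closure C" and h: "h differentiable_on X"
  shows "(SUP x\<in>X. (norm (gradient_on X h x))\<^sup>2) = lip_sq C h"
proof -
  let ?S = "(\<lambda>x. (norm (gradient_on X h x))\<^sup>2) ` X"
  have cont: "continuous_on X h" using h by (rule differentiable_imp_continuous_on)
  have bound: "lip_norm C h \<le> ennreal (sqrt B)" "0 \<le> B"
    if B: "\<And>x. x \<in> X \<Longrightarrow> (norm (gradient_on X h x))\<^sup>2 \<le> B" for B
  proof -
    show B0: "0 \<le> B" using B X(2) by (meson ex_in_conv order_trans zero_le_power2)
    have "norm (gradient_on X h x) \<le> sqrt B" if "x \<in> X" for x
      using B[OF that] by (rule real_le_rsqrt)
    then show "lip_norm C h \<le> ennreal (sqrt B)"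
      using lipschitz_bound_of_gradient[OF X(1) h] lip_norm_le_iff[OF C cont] B0 by simp
  qed
  show ?thesis
  proof (cases "lip_norm C h = \<top>")
    case True
    have "\<not> bdd_above ?S"
    proof
      assume "bdd_above ?S"
      then obtain B where "\<And>x. x \<in> X \<Longrightarrow> (norm (gradient_on X h x))\<^sup>2 \<le> B"
        by (auto simp: bdd_above_def)
      from bound(1)[OF this] True show False by (simp add: top_unique)
    qed
    then show ?thesis using True by (simp add: lip_sq_def Sup_unbounded_real)
  next
    case False
    define L where "L = enn2real (lip_norm C h)"
    have "lipschitz_bound X L h"
      unfolding L_def by (rule lip_norm_lipschitz_bound[OF C cont False])
    then have le: "(norm (gradient_on X h x))\<^sup>2 \<le> L\<^sup>2" if "x \<in> X" for x
      using gradient_norm_le[OF X(1) that h, of L] by (simp add: L_def power_mono)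
    then have bdd: "bdd_above ?S" by (auto simp: bdd_above_def)
    have "(SUP x\<in>X. (norm (gradient_on X h x))\<^sup>2) \<le> L\<^sup>2"
      by (intro cSUP_least le X(2))
    moreover have "L\<^sup>2 \<le> (SUP x\<in>X. (norm (gradient_on X h x))\<^sup>2)"
    proof -
      have ub: "(norm (gradient_on X h x))\<^sup>2 \<le> (SUP x\<in>X. (norm (gradient_on X h x))\<^sup>2)" if "x \<in> X" for x
        using bdd that by (rule cSUP_upper2) simp
      have "L \<le> sqrt (SUP x\<in>X. (norm (gradient_on X h x))\<^sup>2)"
        unfolding L_def using bound[OF ub] by (intro enn2real_leI) auto
      then have "L\<^sup>2 \<le> (sqrt (SUP x\<in>X. (norm (gradient_on X h x))\<^sup>2))\<^sup>2"
        by (rule power_mono) (simp add: L_def)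
      then show ?thesis using bound(2)[OF ub] by simp
    qed
    ultimately show ?thesis using False by (simp add: lip_sq_def L_def)
  qed
qed

lemma lip_sq_measurable:
  assumes "countable C" and "\<And>y. y \<in> C \<Longrightarrow> (\<lambda>w. h w y) \<in> borel_measurable N"
  shows "(\<lambda>w. lip_sq C (h w)) \<in> borel_measurable N"
proof -
  have [measurable]: "(\<lambda>w. lip_norm C (h w)) \<in> borel_measurable N"
    by (rule lip_norm_measurable[OF assms])
  show ?thesis unfolding lip_sq_def by measurable
qed

section \<open>Conditional law of the individual functions\<close>

lemma space_diff_fun_space:
  "\<phi> \<in> space (diff_fun_space X) \<Longrightarrow> \<phi> differentiable_on X"
  by (simp add: diff_fun_space_def space_restrict_space)

lemma measurable_evaluation:
  assumes "x \<in> X"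
  shows "(\<lambda>\<phi>. \<phi> x) \<in> borel_measurable (diff_fun_space X)"
  unfolding diff_fun_space_def
  using assms by (intro measurable_restrict_space1 measurable_component_singleton)

lemma measurable_mean_fun:
  assumes "x \<in> X"
  shows "(\<lambda>Q. mean_fun X Q x) \<in> borel_measurable (prob_algebra (diff_fun_space X))"
proof -
  have "(\<lambda>Q. \<integral>\<phi>. \<phi> x \<partial>Q) \<in> borel_measurable (prob_algebra (diff_fun_space X))"
    unfolding prob_algebra_def
    by (intro measurable_restrict_space1 integral_measurable_subprob_algebra measurable_evaluation assms)
  then show ?thesis using assms by (simp add: mean_fun_def)
qed

text \<open>The history of round \<open>t\<close> contains the functions before \<open>t\<close> but
  the distributions up to and including \<open>t\<close>; hence events about \<open>\<DD> t\<close>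
  belong to it.\<close>

lemma history_subalgebra:
  assumes SEA: "SEA_model M X T \<DD> f" and t: "t \<in> {1..T}"
  shows "subalgebra M (history M X \<DD> f t)"
    and "A \<in> sets (prob_algebra (diff_fun_space X)) \<Longrightarrow>
      \<DD> t -` A \<inter> space M \<in> sets (history M X \<DD> f t)"
proof -
  let ?DF = "diff_fun_space X" and ?PA = "prob_algebra (diff_fun_space X)"
  let ?N = "(\<Pi>\<^sub>M s\<in>{1..<t}. ?DF) \<Otimes>\<^sub>M (\<Pi>\<^sub>M s\<in>{1..t}. ?PA)"
  let ?g = "\<lambda>\<omega>. (\<lambda>s\<in>{1..<t}. f s \<omega>, \<lambda>s\<in>{1..t}. \<DD> s \<omega>)"
  have meas: "\<DD> s \<in> M \<rightarrow>\<^sub>M ?PA" "f s \<in> M \<rightarrow>\<^sub>M ?DF" if "s \<in> {1..T}" for s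
    using SEA that by (auto simp: SEA_model_def)
  have g: "?g \<in> M \<rightarrow>\<^sub>M ?N"
    using t by (intro measurable_Pair measurable_restrict meas) auto
  have sets: "sets (history M X \<DD> f t) = {?g -` A \<inter> space M |A. A \<in> sets ?N}"
    unfolding history_def using g by (intro sets_vimage_algebra2) (auto dest: measurable_space)
  show "subalgebra M (history M X \<DD> f t)"
    unfolding subalgebra_def sets
    using g by (auto simp: history_def dest: measurable_sets)
  assume A: "A \<in> sets ?PA"
  have "(\<lambda>q. snd q t) \<in> ?N \<rightarrow>\<^sub>M ?PA"
    using t by (intro measurable_compose[OF measurable_snd measurable_component_singleton]) auto
  then have "(\<lambda>q. snd q t) -` A \<inter> space ?N \<in> sets ?N" using A by (rule measurable_sets)
  moreover have "\<DD> t -` A \<inter> space M = ?g -` ((\<lambda>q. snd q t) -` A \<inter> space ?N) \<inter> space M"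
    using measurable_space[OF g] t by auto
  ultimately show "\<DD> t -` A \<inter> space M \<in> sets (history M X \<DD> f t)"
    unfolding sets by blast
qed

text \<open>Integrate the conditional probability of \<open>f t \<in> B\<close> over the event
  \<open>\<DD> t \<in> A\<close>, which lies in the history.\<close>

lemma conditional_law_rectangle:
  assumes SEA: "SEA_model M X T \<DD> f" and t: "t \<in> {1..T}"
    and A: "A \<in> sets (prob_algebra (diff_fun_space X))" and B: "B \<in> sets (diff_fun_space X)"
  shows "emeasure M (\<DD> t -` A \<inter> (f t -` B) \<inter> space M)
    = (\<integral>\<^sup>+\<omega>. indicator A (\<DD> t \<omega>) * emeasure (\<DD> t \<omega>) B \<partial>M)"
proof -
  let ?DF = "diff_fun_space X" and ?PA = "prob_algebra (diff_fun_space X)"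
  let ?H = "history M X \<DD> f t"
  interpret prob_space M using SEA by (simp add: SEA_model_def)
  have [measurable]: "\<DD> t \<in> M \<rightarrow>\<^sub>M ?PA" "f t \<in> M \<rightarrow>\<^sub>M ?DF"
    using SEA t by (auto simp: SEA_model_def)
  note [measurable] = A B
  interpret finite_measure_subalgebra M ?H
    by standard (rule history_subalgebra(1)[OF SEA t])
  define E where "E = \<DD> t -` A \<inter> space M"
  define F where "F = f t -` B \<inter> space M"
  have EH: "E \<in> sets ?H" unfolding E_def by (rule history_subalgebra(2)[OF SEA t A])
  have [measurable]: "E \<in> sets M" "F \<in> sets M" unfolding E_def F_def by measurable
  have meas: "(\<lambda>\<omega>. measure (\<DD> t \<omega>) B) \<in> borel_measurable M" by measurable
  have prob: "prob_space (\<DD> t \<omega>)" if "\<omega> \<in> space M" for \<omega>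
    using measurable_space[OF \<open>\<DD> t \<in> M \<rightarrow>\<^sub>M ?PA\<close> that] by (simp add: space_prob_algebra)
  have "(\<integral>\<omega>\<in>E. indicator F \<omega> \<partial>M) = (\<integral>\<omega>\<in>E. real_cond_exp M ?H (indicator F) \<omega> \<partial>M)"
    by (rule real_cond_exp_intA[OF _ EH])
      (auto intro!: integrable_real_indicator simp: emeasure_eq_measure)
  also have "\<dots> = (\<integral>\<omega>\<in>E. measure (\<DD> t \<omega>) B \<partial>M)"
    unfolding set_lebesgue_integral_def
  proof (rule integral_cong_AE)
    have "AE \<omega> in M. real_cond_exp M ?H (indicator F) \<omega> = measure (\<DD> t \<omega>) B"
      using SEA t B unfolding F_def by (auto simp: SEA_model_def)
    then show "AE \<omega> in M. indicator E \<omega> *\<^sub>R real_cond_exp M ?H (indicator F) \<omega>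
        = indicator E \<omega> *\<^sub>R measure (\<DD> t \<omega>) B"
      by eventually_elim simp
  qed (use meas in auto)
  finally have eq: "measure M (E \<inter> F) = (\<integral>\<omega>. indicator E \<omega> * measure (\<DD> t \<omega>) B \<partial>M)"
    by (simp add: set_lebesgue_integral_def indicator_inter_arith[symmetric])
  have "emeasure M (E \<inter> F) = ennreal (\<integral>\<omega>. indicator E \<omega> * measure (\<DD> t \<omega>) B \<partial>M)"
    by (simp add: emeasure_eq_measure eq)
  also have "\<dots> = (\<integral>\<^sup>+\<omega>. ennreal (indicator E \<omega> * measure (\<DD> t \<omega>) B) \<partial>M)"
  proof (rule nn_integral_eq_integral[symmetric])
    show "integrable M (\<lambda>\<omega>. indicator E \<omega> * measure (\<DD> t \<omega>) B)"
      using meas prob by (intro integrable_const_bound[where B = 1])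
        (auto simp: indicator_def prob_space.prob_le_1)
  qed auto
  also have "\<dots> = (\<integral>\<^sup>+\<omega>. indicator A (\<DD> t \<omega>) * emeasure (\<DD> t \<omega>) B \<partial>M)"
  proof (rule nn_integral_cong)
    fix \<omega> assume \<omega>: "\<omega> \<in> space M"
    interpret D: prob_space "\<DD> t \<omega>" by (rule prob[OF \<omega>])
    show "ennreal (indicator E \<omega> * measure (\<DD> t \<omega>) B) = indicator A (\<DD> t \<omega>) * emeasure (\<DD> t \<omega>) B"
      using \<omega> by (simp add: E_def indicator_def D.emeasure_eq_measure)
  qed
  also have "E \<inter> F = \<DD> t -` A \<inter> (f t -` B) \<inter> space M" by (auto simp: E_def F_def)
  finally show ?thesis .
qed

text \<open>Disintegration: the joint law of distribution and sample is a mixture of kernels, as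
  both measures agree on rectangles, an intersection-stable generator. The integrand may depend on
  the distribution too, as is needed for the deviation of a sample from its own mean.\<close>

lemma conditional_law:
  assumes SEA: "SEA_model M X T \<DD> f" and t: "t \<in> {1..T}"
    and k: "k \<in> borel_measurable (prob_algebra (diff_fun_space X) \<Otimes>\<^sub>M diff_fun_space X)"
  shows "(\<integral>\<^sup>+\<omega>. k (\<DD> t \<omega>, f t \<omega>) \<partial>M) = (\<integral>\<^sup>+\<omega>. \<integral>\<^sup>+\<phi>. k (\<DD> t \<omega>, \<phi>) \<partial>\<DD> t \<omega> \<partial>M)"
proof -
  let ?DF = "diff_fun_space X" and ?PA = "prob_algebra (diff_fun_space X)"
  let ?P = "?PA \<Otimes>\<^sub>M ?DF"
  interpret prob_space M using SEA by (simp add: SEA_model_def)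
  have D: "\<DD> t \<in> M \<rightarrow>\<^sub>M ?PA" and [measurable]: "\<DD> t \<in> M \<rightarrow>\<^sub>M ?PA" "f t \<in> M \<rightarrow>\<^sub>M ?DF"
    using SEA t by (auto simp: SEA_model_def)
  define K where "K \<omega> = distr (\<DD> t \<omega>) ?P (\<lambda>\<phi>. (\<DD> t \<omega>, \<phi>))" for \<omega>
  have "case_prod (\<lambda>\<omega> \<phi>. (\<DD> t \<omega>, \<phi>)) \<in> M \<Otimes>\<^sub>M ?DF \<rightarrow>\<^sub>M ?P"
    unfolding split_beta' by measurable
  then have K[measurable]: "K \<in> M \<rightarrow>\<^sub>M subprob_algebra ?P"
    unfolding K_def by (rule measurable_distr2[OF _ measurable_prob_algebraD[OF D]])
  have setsD: "sets (\<DD> t \<omega>) = sets ?DF" if "\<omega> \<in> space M" for \<omega>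
    using measurable_space[OF D that] by (simp add: space_prob_algebra)
  have pair: "(\<lambda>\<phi>. (\<DD> t \<omega>, \<phi>)) \<in> \<DD> t \<omega> \<rightarrow>\<^sub>M ?P" if "\<omega> \<in> space M" for \<omega>
    unfolding measurable_cong_sets[OF setsD[OF that] refl]
    by (rule measurable_Pair1'[OF measurable_space[OF D that]])
  let ?joint = "distr M ?P (\<lambda>\<omega>. (\<DD> t \<omega>, f t \<omega>))"
  have setsK: "sets (M \<bind> K) = sets ?P"
    by (rule sets_bind[OF sets_kernel[OF K] not_empty])
  have "?joint = M \<bind> K"
  proof (rule measure_eqI_generator_eq[where A = "\<lambda>_. space ?PA \<times> space ?DF"])
    let ?E = "{a \<times> b |a b. a \<in> sets ?PA \<and> b \<in> sets ?DF}"
    show "Int_stable ?E" by (rule Int_stable_pair_measure_generator)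
    show "?E \<subseteq> Pow (space ?PA \<times> space ?DF)"
      using sets.sets_into_space[of _ ?PA] sets.sets_into_space[of _ ?DF] by blast
    show "sets ?joint = sigma_sets (space ?PA \<times> space ?DF) ?E"
      by (simp add: sets_pair_measure)
    show "sets (M \<bind> K) = sigma_sets (space ?PA \<times> space ?DF) ?E"
      by (simp add: setsK sets_pair_measure)
    show "emeasure ?joint (space ?PA \<times> space ?DF) \<noteq> \<infinity>" for i :: nat
      by (simp add: emeasure_distr)
    fix R assume "R \<in> ?E"
    then obtain A B where R: "R = A \<times> B" and A: "A \<in> sets ?PA" and B: "B \<in> sets ?DF" by auto
    have RP: "R \<in> sets ?P" unfolding R using A B by (rule pair_measureI)
    have "emeasure ?joint R = emeasure M (\<DD> t -` A \<inter> (f t -` B) \<inter> space M)"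
      using RP unfolding R by (subst emeasure_distr) (auto intro!: arg_cong[where f = "emeasure M"])
    also have "\<dots> = (\<integral>\<^sup>+\<omega>. indicator A (\<DD> t \<omega>) * emeasure (\<DD> t \<omega>) B \<partial>M)"
      by (rule conditional_law_rectangle[OF SEA t A B])
    also have "\<dots> = (\<integral>\<^sup>+\<omega>. emeasure (K \<omega>) R \<partial>M)"
    proof (rule nn_integral_cong)
      fix \<omega> assume \<omega>: "\<omega> \<in> space M"
      have "(\<lambda>\<phi>. (\<DD> t \<omega>, \<phi>)) -` R \<inter> space (\<DD> t \<omega>) = (if \<DD> t \<omega> \<in> A then B else {})"
        using sets.sets_into_space[OF B] sets_eq_imp_space_eq[OF setsD[OF \<omega>]] by (auto simp: R)
      then show "indicator A (\<DD> t \<omega>) * emeasure (\<DD> t \<omega>) B = emeasure (K \<omega>) R"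
        using RP unfolding K_def by (subst emeasure_distr[OF pair[OF \<omega>]]) auto
    qed
    also have "\<dots> = emeasure (M \<bind> K) R"
      by (rule emeasure_bind[OF not_empty K RP, symmetric])
    finally show "emeasure ?joint R = emeasure (M \<bind> K) R" .
  qed auto
  then have "(\<integral>\<^sup>+q. k q \<partial>?joint) = (\<integral>\<^sup>+q. k q \<partial>(M \<bind> K))" by simp
  also have "\<dots> = (\<integral>\<^sup>+\<omega>. \<integral>\<^sup>+q. k q \<partial>K \<omega> \<partial>M)" by (rule nn_integral_bind[OF k K])
  also have "\<dots> = (\<integral>\<^sup>+\<omega>. \<integral>\<^sup>+\<phi>. k (\<DD> t \<omega>, \<phi>) \<partial>\<DD> t \<omega> \<partial>M)"
    unfolding K_def using k pair by (intro nn_integral_cong nn_integral_distr) auto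
  finally show ?thesis using k by (simp add: nn_integral_distr)
qed

text \<open>The distribution occurs both as the measure and inside the integrand. Passing to the
  kernel on pairs removes the second dependence.\<close>

lemma conditional_integral_measurable:
  fixes k :: "'b measure \<times> 'b \<Rightarrow> real"
  assumes D: "D \<in> M \<rightarrow>\<^sub>M prob_algebra N" and k: "k \<in> borel_measurable (prob_algebra N \<Otimes>\<^sub>M N)"
  shows "(\<lambda>\<omega>. \<integral>\<phi>. k (D \<omega>, \<phi>) \<partial>D \<omega>) \<in> borel_measurable M"
proof -
  let ?P = "prob_algebra N \<Otimes>\<^sub>M N"
  define K where "K \<omega> = distr (D \<omega>) ?P (\<lambda>\<phi>. (D \<omega>, \<phi>))" for \<omega>
  note [measurable] = D
  have "case_prod (\<lambda>\<omega> \<phi>. (D \<omega>, \<phi>)) \<in> M \<Otimes>\<^sub>M N \<rightarrow>\<^sub>M ?P"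
    unfolding split_beta' by measurable
  then have K: "K \<in> M \<rightarrow>\<^sub>M subprob_algebra ?P"
    unfolding K_def by (rule measurable_distr2[OF _ measurable_prob_algebraD[OF D]])
  have "(\<lambda>\<omega>. \<integral>q. k q \<partial>K \<omega>) \<in> borel_measurable M"
    using K integral_measurable_subprob_algebra[OF k] by (rule measurable_compose)
  moreover have "(\<integral>q. k q \<partial>K \<omega>) = (\<integral>\<phi>. k (D \<omega>, \<phi>) \<partial>D \<omega>)" if \<omega>: "\<omega> \<in> space M" for \<omega>
  proof -
    have D\<omega>: "D \<omega> \<in> space (prob_algebra N)" by (rule measurable_space[OF D \<omega>])
    then have "sets (D \<omega>) = sets N" by (simp add: space_prob_algebra)
    then have "(\<lambda>\<phi>. (D \<omega>, \<phi>)) \<in> D \<omega> \<rightarrow>\<^sub>M ?P"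
      using measurable_Pair1'[OF D\<omega>, of N] by (simp cong: measurable_cong_sets)
    then show ?thesis unfolding K_def using k by (rule integral_distr)
  qed
  ultimately show ?thesis by (simp cong: measurable_cong)
qed

section \<open>Expected variation of the individual functions\<close>

lemma lip_norm_diff_le: "lip_norm C (\<lambda>y. h y - k y) \<le> lip_norm C h + lip_norm C k"
proof -
  have up: "ennreal (\<bar>h y - h z\<bar> / norm (y - z)) \<le> lip_norm C h" if "y \<in> C" "z \<in> C"
    for h :: "'a \<Rightarrow> real" and y z
    unfolding lip_norm_def using that by (meson SUP_upper order_trans)
  show ?thesis
    unfolding lip_norm_def[of C "\<lambda>y. h y - k y"]
  proof (intro SUP_least)
    fix y z assume yz: "y \<in> C" "z \<in> C"
    have "ennreal (\<bar>h y - k y - (h z - k z)\<bar> / norm (y - z))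
        \<le> ennreal (\<bar>h y - h z\<bar> / norm (y - z) + \<bar>k y - k z\<bar> / norm (y - z))"
      unfolding add_divide_distrib[symmetric] by (intro ennreal_leI divide_right_mono) auto
    also have "\<dots> = ennreal (\<bar>h y - h z\<bar> / norm (y - z)) + ennreal (\<bar>k y - k z\<bar> / norm (y - z))"
      by (simp add: ennreal_plus)
    also have "\<dots> \<le> lip_norm C h + lip_norm C k"
      by (intro add_mono up yz)
    finally show "ennreal (\<bar>h y - k y - (h z - k z)\<bar> / norm (y - z)) \<le> lip_norm C h + lip_norm C k" .
  qed
qed

lemma lip_norm_zero: "lip_norm C (\<lambda>_. 0) = 0"
  using lip_norm_leI[of C "\<lambda>_. 0" 0] by simp

lemma lip_sq_finite:
  assumes "lip_norm C h \<noteq> \<top>"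
  shows "lip_sq C h = (enn2real (lip_norm C h))\<^sup>2"
  using assms by (simp add: lip_sq_def)

lemma sum_shift_le:
  fixes a :: "nat \<Rightarrow> real"
  assumes "a 0 = 0" "\<And>t. 0 \<le> a t"
  shows "(\<Sum>t=1..n. a (t - 1)) \<le> (\<Sum>t=1..n. a t)"
proof -
  have "(\<Sum>t=1..n. a (t - 1)) + a n = (\<Sum>t=1..n. a t)"
    using assms(1) by (induction n) auto
  with assms(2)[of n] show ?thesis by linarith
qed

lemma sum3_power2_le:
  fixes a b c :: real
  shows "(a + b + c)\<^sup>2 \<le> 3 * (a\<^sup>2 + b\<^sup>2 + c\<^sup>2)"
proof -
  have "0 \<le> (a - b)\<^sup>2 + (b - c)\<^sup>2 + (a - c)\<^sup>2" by simp
  then show ?thesis by (simp add: power2_eq_square algebra_simps)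
qed

text \<open>Only the random functions are fixed here: their variation is bounded without reference
  to algorithm or comparators.\<close>

locale lipschitz_sea =
  fixes M :: "'w measure" and X :: "'a::euclidean_space set" and T :: nat
    and \<DD> :: "nat \<Rightarrow> 'w \<Rightarrow> ('a \<Rightarrow> real) measure" and f :: "nat \<Rightarrow> 'w \<Rightarrow> 'a \<Rightarrow> real"
    and G :: real and C :: "'a set"
  assumes convex: "convex X" and nonempty: "X \<noteq> {}"
    and C: "countable C" "C \<subseteq> X" "X \<subseteq> closure C"
    and SEA: "SEA_model M X T \<DD> f" and G: "G > 0"
    and gradient_bound: "\<And>\<omega> t y. \<omega> \<in> space M \<Longrightarrow> t \<in> {1..T} \<Longrightarrow> y \<in> X \<Longrightarrow>
      norm (gradient_on X (f t \<omega>) y) \<le> G"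
begin

sublocale prob_space M
  using SEA by (simp add: SEA_model_def)

abbreviation "DF \<equiv> diff_fun_space X"
abbreviation "PA \<equiv> prob_algebra DF"

lemma measurable_model:
  assumes "t \<in> {1..T}"
  shows "\<DD> t \<in> M \<rightarrow>\<^sub>M PA" "f t \<in> M \<rightarrow>\<^sub>M DF"
  using SEA assms by (auto simp: SEA_model_def)

lemma f_differentiable: "t \<in> {1..T} \<Longrightarrow> \<omega> \<in> space M \<Longrightarrow> f t \<omega> differentiable_on X"
  using measurable_space[OF measurable_model(2)] by (blast intro: space_diff_fun_space)

lemma f_lipschitz:
  assumes "t \<in> {1..T}" "\<omega> \<in> space M"
  shows "lipschitz_bound X G (f t \<omega>)"
  using lipschitz_bound_of_gradient[OF convex f_differentiable] gradient_bound assms by blast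

lemma lip_norm_f:
  assumes "t \<in> {1..T}" "\<omega> \<in> space M"
  shows "lip_norm C (f t \<omega>) \<le> ennreal G"
  using lip_norm_leI[of C "f t \<omega>" G] lipschitz_boundD[OF f_lipschitz[OF assms]] C G by auto

section \<open>Lipschitz bounds for samples and expected functions\<close>

definition F :: "nat \<Rightarrow> 'w \<Rightarrow> 'a \<Rightarrow> real" where
  "F t \<omega> = (if t = 0 then (\<lambda>_. 0) else mean_fun X (\<DD> t \<omega>))"

lemma F_differentiable:
  assumes "t \<le> T" "\<omega> \<in> space M"
  shows "F t \<omega> differentiable_on X"
  using SEA assms by (cases "t = 0") (auto simp: F_def SEA_model_def grad_interchange_def)

lemma F_measurable:
  assumes "t \<le> T" "y \<in> X"
  shows "(\<lambda>\<omega>. F t \<omega> y) \<in> borel_measurable M"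
proof (cases "t = 0")
  case False
  then have "t \<in> {1..T}" using assms by auto
  from measurable_compose[OF measurable_model(1)[OF this] measurable_mean_fun[OF assms(2)]]
  show ?thesis using False by (simp add: F_def)
qed (simp add: F_def)

lemma f_measurable:
  assumes "t \<in> {1..T}" "y \<in> X"
  shows "(\<lambda>\<omega>. f t \<omega> y) \<in> borel_measurable M"
  by (rule measurable_compose[OF measurable_model(2)[OF assms(1)] measurable_evaluation[OF assms(2)]])

lemma DD_props:
  assumes "t \<in> {1..T}" "\<omega> \<in> space M"
  shows "prob_space (\<DD> t \<omega>)" "sets (\<DD> t \<omega>) = sets DF" "space (\<DD> t \<omega>) = space DF"
  using measurable_space[OF measurable_model(1)[OF assms(1)] assms(2)]
  by (auto simp: space_prob_algebra dest: sets_eq_imp_space_eq)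

lemma evaluation_measurable:
  assumes "t \<in> {1..T}" "\<omega> \<in> space M" "y \<in> X"
  shows "(\<lambda>\<phi>. \<phi> y) \<in> borel_measurable (\<DD> t \<omega>)"
  using measurable_evaluation[OF assms(3)] measurable_cong_sets[OF DD_props(2)[OF assms(1,2)] refl]
  by blast

text \<open>The set of functions violating the bound is never hit by \<open>f t\<close>. By the
  conditional law its mean probability under \<open>\<DD> t\<close> is zero, hence so is almost
  every single one.\<close>

lemma AE_sample_lipschitz:
  assumes t: "t \<in> {1..T}"
  shows "AE \<omega> in M. AE \<phi> in \<DD> t \<omega>. lip_norm C \<phi> \<le> ennreal G"
proof -
  have lip: "(\<lambda>\<phi>. lip_norm C \<phi>) \<in> borel_measurable DF"
    using C by (intro lip_norm_measurable measurable_evaluation) auto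
  define k where "k q = (indicator {\<phi>\<in>space DF. \<not> lip_norm C \<phi> \<le> ennreal G} (snd q) :: ennreal)"
    for q :: "('a \<Rightarrow> real) measure \<times> ('a \<Rightarrow> real)"
  have set: "{\<phi>\<in>space DF. \<not> lip_norm C \<phi> \<le> ennreal G} \<in> sets DF"
    using lip by measurable
  have k: "k \<in> borel_measurable (PA \<Otimes>\<^sub>M DF)"
    unfolding k_def using set by measurable
  have "(\<integral>\<^sup>+\<omega>. \<integral>\<^sup>+\<phi>. k (\<DD> t \<omega>, \<phi>) \<partial>\<DD> t \<omega> \<partial>M) = (\<integral>\<^sup>+\<omega>. k (\<DD> t \<omega>, f t \<omega>) \<partial>M)"
    by (rule conditional_law[OF SEA t k, symmetric])
  also have "\<dots> = (\<integral>\<^sup>+\<omega>. 0 \<partial>M)"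
    using lip_norm_f[OF t] by (intro nn_integral_cong) (auto simp: k_def)
  finally have zero: "(\<integral>\<^sup>+\<omega>. \<integral>\<^sup>+\<phi>. k (\<DD> t \<omega>, \<phi>) \<partial>\<DD> t \<omega> \<partial>M) = 0" by simp
  have inner: "(\<integral>\<^sup>+\<phi>. k (\<DD> t \<omega>, \<phi>) \<partial>\<DD> t \<omega>) = emeasure (\<DD> t \<omega>) {\<phi>\<in>space DF. \<not> lip_norm C \<phi> \<le> ennreal G}"
    if "\<omega> \<in> space M" for \<omega>
    using set DD_props(2)[OF t that] by (simp add: k_def)
  have "(\<lambda>\<omega>. emeasure (\<DD> t \<omega>) {\<phi>\<in>space DF. \<not> lip_norm C \<phi> \<le> ennreal G}) \<in> borel_measurable M"
    by (rule measurable_compose[OF measurable_prob_algebraD[OF measurable_model(1)[OF t]]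
          measurable_emeasure_subprob_algebra[OF set]])
  moreover have "(\<integral>\<^sup>+\<omega>. emeasure (\<DD> t \<omega>) {\<phi>\<in>space DF. \<not> lip_norm C \<phi> \<le> ennreal G} \<partial>M) = 0"
    using zero inner by (simp cong: nn_integral_cong)
  ultimately have "AE \<omega> in M. emeasure (\<DD> t \<omega>) {\<phi>\<in>space DF. \<not> lip_norm C \<phi> \<le> ennreal G} = 0"
    by (simp add: nn_integral_0_iff_AE)
  then show ?thesis
    using AE_space
  proof eventually_elim
    case (elim \<omega>)
    then show ?case
      using set DD_props[OF t, of \<omega>] by (intro AE_I[OF _ _ ]) auto
  qed
qed

text \<open>Integrate the Lipschitz inequality of almost every sample at two fixed points; the
  evaluations are integrable by the interchange condition.\<close>

lemma AE_F_lipschitz: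
  assumes t: "t \<le> T"
  shows "AE \<omega> in M. lip_norm C (F t \<omega>) \<le> ennreal G"
proof (cases "t = 0")
  case True
  then show ?thesis by (simp add: F_def lip_norm_zero)
next
  case False
  then have t': "t \<in> {1..T}" using t by auto
  show ?thesis
    using AE_sample_lipschitz[OF t'] AE_space
  proof eventually_elim
    case (elim \<omega>)
    interpret D: prob_space "\<DD> t \<omega>" by (rule DD_props(1)[OF t' elim(2)])
    have int: "integrable (\<DD> t \<omega>) (\<lambda>\<phi>. \<phi> y)" if "y \<in> X" for y
      using SEA t' elim(2) that by (auto simp: SEA_model_def grad_interchange_def)
    show "lip_norm C (F t \<omega>) \<le> ennreal G"
    proof (rule lip_norm_leI)
      fix y z assume "y \<in> C" "z \<in> C"
      then have yz: "y \<in> X" "z \<in> X" using C by auto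
      have bnd: "AE \<phi> in \<DD> t \<omega>. \<bar>\<phi> y - \<phi> z\<bar> \<le> G * norm (y - z)"
        using elim(1) AE_space
      proof eventually_elim
        case (elim \<phi>)
        then have "\<phi> differentiable_on X"
          using DD_props(3)[OF t' \<open>\<omega> \<in> space M\<close>] by (auto intro: space_diff_fun_space)
        then show ?case
          using lip_norm_le_iff[OF C(2,3) differentiable_imp_continuous_on, of \<phi> G] elim G yz
          by (auto dest: lipschitz_boundD)
      qed
      have "\<bar>F t \<omega> y - F t \<omega> z\<bar> = \<bar>\<integral>\<phi>. \<phi> y - \<phi> z \<partial>\<DD> t \<omega>\<bar>"
        using False yz int by (simp add: F_def mean_fun_def)
      also have "\<dots> \<le> (\<integral>\<phi>. \<bar>\<phi> y - \<phi> z\<bar> \<partial>\<DD> t \<omega>)" by (rule integral_abs_bound)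
      also have "\<dots> \<le> (\<integral>\<phi>. G * norm (y - z) \<partial>\<DD> t \<omega>)"
        using int yz bnd by (intro integral_mono_AE) auto
      also have "\<dots> = G * norm (y - z)" by (simp add: D.prob_space)
      finally show "\<bar>F t \<omega> y - F t \<omega> z\<bar> \<le> G * norm (y - z)" .
    qed (use G in simp)
  qed
qed

section \<open>Deviation of a sample from its conditional mean\<close>

definition deviation :: "('a \<Rightarrow> real) measure \<Rightarrow> ('a \<Rightarrow> real) \<Rightarrow> ennreal" where
  "deviation Q \<phi> = lip_norm C (\<lambda>y. \<phi> y - mean_fun X Q y)"

lemma pair_diff_measurable:
  assumes "y \<in> C"
  shows "(\<lambda>q. snd q y - mean_fun X (fst q) y) \<in> borel_measurable (PA \<Otimes>\<^sub>M DF)"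
proof -
  have y: "y \<in> X" using assms C by auto
  show ?thesis
    by (intro borel_measurable_diff measurable_compose[OF measurable_snd measurable_evaluation[OF y]]
        measurable_compose[OF measurable_fst measurable_mean_fun[OF y]])
qed

lemma deviation_measurable: "(\<lambda>q. deviation (fst q) (snd q)) \<in> borel_measurable (PA \<Otimes>\<^sub>M DF)"
  unfolding deviation_def by (rule lip_norm_measurable[OF C(1) pair_diff_measurable])

lemma AE_deviation_le:
  assumes t: "t \<in> {1..T}"
  shows "AE \<omega> in M. deviation (\<DD> t \<omega>) (f t \<omega>) \<le> ennreal (2 * G)"
    and "AE \<omega> in M. AE \<phi> in \<DD> t \<omega>. deviation (\<DD> t \<omega>) \<phi> \<le> ennreal (2 * G)"
proof -
  have Fm: "F t \<omega> = mean_fun X (\<DD> t \<omega>)" for \<omega> using t by (simp add: F_def)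
  have G2: "ennreal (2 * G) = ennreal G + ennreal G"
    using G by (subst ennreal_plus[symmetric]) auto
  have le: "deviation (\<DD> t \<omega>) \<phi> \<le> ennreal (2 * G)"
    if "lip_norm C (F t \<omega>) \<le> ennreal G" "lip_norm C \<phi> \<le> ennreal G" for \<omega> \<phi>
    unfolding G2 deviation_def
    by (rule order_trans[OF lip_norm_diff_le add_mono[OF that(2) that(1)[unfolded Fm]]])
  have F: "AE \<omega> in M. lip_norm C (F t \<omega>) \<le> ennreal G" using t by (intro AE_F_lipschitz) auto
  show "AE \<omega> in M. deviation (\<DD> t \<omega>) (f t \<omega>) \<le> ennreal (2 * G)"
    using F AE_space by eventually_elim (auto intro: le lip_norm_f[OF t])
  show "AE \<omega> in M. AE \<phi> in \<DD> t \<omega>. deviation (\<DD> t \<omega>) \<phi> \<le> ennreal (2 * G)"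
    using F AE_sample_lipschitz[OF t]
  proof eventually_elim
    case (elim \<omega>)
    from elim(2) show ?case by eventually_elim (rule le[OF elim(1)])
  qed
qed

lemma deviation_f_measurable:
  assumes "t \<in> {1..T}"
  shows "(\<lambda>\<omega>. deviation (\<DD> t \<omega>) (f t \<omega>)) \<in> borel_measurable M"
  using measurable_compose[OF measurable_Pair[OF measurable_model[OF assms]] deviation_measurable]
  by simp

text \<open>Valid at every sample point, including those with unbounded suprema, so that
  measurability of the left side can be read off the right side.\<close>

lemma sigma_tilde_eq:
  assumes t: "t \<in> {1..T}" and \<omega>: "\<omega> \<in> space M"
  shows "sigma_tilde_sq X (\<DD> t \<omega>) = (\<integral>\<phi>. lip_sq C (\<lambda>y. \<phi> y - mean_fun X (\<DD> t \<omega>) y) \<partial>\<DD> t \<omega>)"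
  unfolding sigma_tilde_sq_def
proof (rule Bochner_Integration.integral_cong[OF refl])
  fix \<phi> assume "\<phi> \<in> space (\<DD> t \<omega>)"
  then have \<phi>: "\<phi> differentiable_on X"
    using DD_props(3)[OF t \<omega>] by (auto intro: space_diff_fun_space)
  have m: "mean_fun X (\<DD> t \<omega>) differentiable_on X"
    using F_differentiable[of t \<omega>] t \<omega> by (simp add: F_def)
  have "(SUP x\<in>X. (norm (gradient_on X \<phi> x - gradient_on X (mean_fun X (\<DD> t \<omega>)) x))\<^sup>2)
      = (SUP x\<in>X. (norm (gradient_on X (\<lambda>y. \<phi> y - mean_fun X (\<DD> t \<omega>) y) x))\<^sup>2)"
    using gradient_on_diff[OF convex _ \<phi> m] by (intro SUP_cong) auto
  also have "\<dots> = lip_sq C (\<lambda>y. \<phi> y - mean_fun X (\<DD> t \<omega>) y)"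
    using SUP_gradient_sq[OF convex nonempty C(2,3) differentiable_on_diff[OF \<phi> m]] .
  finally show "(SUP x\<in>X. (norm (gradient_on X \<phi> x - gradient_on X (mean_fun X (\<DD> t \<omega>)) x))\<^sup>2)
      = lip_sq C (\<lambda>y. \<phi> y - mean_fun X (\<DD> t \<omega>) y)" .
qed

lemma sigma_tilde_measurable:
  assumes t: "t \<in> {1..T}"
  shows "(\<lambda>\<omega>. sigma_tilde_sq X (\<DD> t \<omega>)) \<in> borel_measurable M"
proof -
  have "(\<lambda>q. lip_sq C (\<lambda>y. snd q y - mean_fun X (fst q) y)) \<in> borel_measurable (PA \<Otimes>\<^sub>M DF)"
    by (rule lip_sq_measurable[OF C(1) pair_diff_measurable])
  from conditional_integral_measurable[OF measurable_model(1)[OF t] this]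
  show ?thesis by (simp add: sigma_tilde_eq[OF t] cong: measurable_cong)
qed

text \<open>Almost surely the deviation is at most \<open>2 * G\<close>, so the integral in
  \<open>sigma_tilde_sq\<close> is a genuine one and agrees with the nonnegative integral that the
  conditional law requires.\<close>

lemma AE_sigma_tilde:
  assumes t: "t \<in> {1..T}"
  shows "AE \<omega> in M. 0 \<le> sigma_tilde_sq X (\<DD> t \<omega>) \<and>
    ennreal (sigma_tilde_sq X (\<DD> t \<omega>)) = (\<integral>\<^sup>+\<phi>. ennreal ((enn2real (deviation (\<DD> t \<omega>) \<phi>))\<^sup>2) \<partial>\<DD> t \<omega>)"
  using AE_deviation_le(2)[OF t] AE_space
proof eventually_elim
  case (elim \<omega>)
  note \<omega> = elim(2)
  interpret D: prob_space "\<DD> t \<omega>" by (rule DD_props(1)[OF t \<omega>])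
  have dev: "(\<lambda>\<phi>. deviation (\<DD> t \<omega>) \<phi>) \<in> borel_measurable (\<DD> t \<omega>)"
    unfolding deviation_def using C
    by (intro lip_norm_measurable borel_measurable_diff evaluation_measurable[OF t \<omega>]) auto
  then have meas: "(\<lambda>\<phi>. (enn2real (deviation (\<DD> t \<omega>) \<phi>))\<^sup>2) \<in> borel_measurable (\<DD> t \<omega>)"
    by measurable
  have lsq: "(\<lambda>\<phi>. lip_sq C (\<lambda>y. \<phi> y - mean_fun X (\<DD> t \<omega>) y)) \<in> borel_measurable (\<DD> t \<omega>)"
    using C by (intro lip_sq_measurable borel_measurable_diff evaluation_measurable[OF t \<omega>]) auto
  have eq: "AE \<phi> in \<DD> t \<omega>. lip_sq C (\<lambda>y. \<phi> y - mean_fun X (\<DD> t \<omega>) y) = (enn2real (deviation (\<DD> t \<omega>) \<phi>))\<^sup>2"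
    using elim(1)
  proof eventually_elim
    case (elim \<phi>)
    then have "deviation (\<DD> t \<omega>) \<phi> \<noteq> \<top>" by (auto simp: top_unique)
    then show ?case unfolding deviation_def by (rule lip_sq_finite)
  qed
  have int: "integrable (\<DD> t \<omega>) (\<lambda>\<phi>. (enn2real (deviation (\<DD> t \<omega>) \<phi>))\<^sup>2)"
  proof (rule D.integrable_const_bound[OF _ meas])
    show "AE \<phi> in \<DD> t \<omega>. norm ((enn2real (deviation (\<DD> t \<omega>) \<phi>))\<^sup>2) \<le> (2 * G)\<^sup>2"
      using elim(1)
    proof eventually_elim
      case (elim \<phi>)
      then have "enn2real (deviation (\<DD> t \<omega>) \<phi>) \<le> 2 * G" using G by (intro enn2real_leI) auto
      then show ?case using power_mono[of "enn2real (deviation (\<DD> t \<omega>) \<phi>)" "2 * G" 2] by simp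
    qed
  qed
  have st: "sigma_tilde_sq X (\<DD> t \<omega>) = (\<integral>\<phi>. (enn2real (deviation (\<DD> t \<omega>) \<phi>))\<^sup>2 \<partial>\<DD> t \<omega>)"
    unfolding sigma_tilde_eq[OF t \<omega>] by (rule integral_cong_AE[OF lsq meas eq])
  then show ?case
    using nn_integral_eq_integral[OF int] by simp
qed

text \<open>Tower property: averaging the conditional expectation over \<open>\<DD> t\<close> gives
  the expectation at the realised function \<open>f t\<close>.\<close>

lemma expected_sigma_tilde:
  assumes t: "t \<in> {1..T}"
  shows "integrable M (\<lambda>\<omega>. (enn2real (deviation (\<DD> t \<omega>) (f t \<omega>)))\<^sup>2)"
    and "integrable M (\<lambda>\<omega>. sigma_tilde_sq X (\<DD> t \<omega>))"
    and "(\<integral>\<omega>. sigma_tilde_sq X (\<DD> t \<omega>) \<partial>M) = (\<integral>\<omega>. (enn2real (deviation (\<DD> t \<omega>) (f t \<omega>)))\<^sup>2 \<partial>M)"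
proof -
  let ?s = "\<lambda>\<omega>. (enn2real (deviation (\<DD> t \<omega>) (f t \<omega>)))\<^sup>2"
  have s_meas: "?s \<in> borel_measurable M"
    using deviation_f_measurable[OF t] by measurable
  show s_int: "integrable M ?s"
  proof (rule integrable_const_bound[OF _ s_meas])
    show "AE \<omega> in M. norm (?s \<omega>) \<le> (2 * G)\<^sup>2"
      using AE_deviation_le(1)[OF t]
    proof eventually_elim
      case (elim \<omega>)
      then have "enn2real (deviation (\<DD> t \<omega>) (f t \<omega>)) \<le> 2 * G" using G by (intro enn2real_leI) auto
      then show ?case using power_mono[of "enn2real (deviation (\<DD> t \<omega>) (f t \<omega>))" "2 * G" 2] by simp
    qed
  qed
  define k where "k q = ennreal ((enn2real (deviation (fst q) (snd q)))\<^sup>2)"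
    for q :: "('a \<Rightarrow> real) measure \<times> ('a \<Rightarrow> real)"
  have k: "k \<in> borel_measurable (PA \<Otimes>\<^sub>M DF)"
    unfolding k_def using deviation_measurable by measurable
  have "(\<integral>\<^sup>+\<omega>. ennreal (sigma_tilde_sq X (\<DD> t \<omega>)) \<partial>M) = (\<integral>\<^sup>+\<omega>. \<integral>\<^sup>+\<phi>. k (\<DD> t \<omega>, \<phi>) \<partial>\<DD> t \<omega> \<partial>M)"
    using AE_sigma_tilde[OF t] by (intro nn_integral_cong_AE) (auto simp: k_def)
  also have "\<dots> = (\<integral>\<^sup>+\<omega>. k (\<DD> t \<omega>, f t \<omega>) \<partial>M)"
    by (rule conditional_law[OF SEA t k, symmetric])
  also have "\<dots> = ennreal (\<integral>\<omega>. ?s \<omega> \<partial>M)"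
    using nn_integral_eq_integral[OF s_int] by (simp add: k_def)
  finally have nn: "(\<integral>\<^sup>+\<omega>. ennreal (sigma_tilde_sq X (\<DD> t \<omega>)) \<partial>M) = ennreal (\<integral>\<omega>. ?s \<omega> \<partial>M)" .
  have pos: "AE \<omega> in M. 0 \<le> sigma_tilde_sq X (\<DD> t \<omega>)"
    using AE_sigma_tilde[OF t] by eventually_elim auto
  show "integrable M (\<lambda>\<omega>. sigma_tilde_sq X (\<DD> t \<omega>))"
    using sigma_tilde_measurable[OF t] pos nn by (intro integrableI_nn_integral_finite) auto
  show "(\<integral>\<omega>. sigma_tilde_sq X (\<DD> t \<omega>) \<partial>M) = (\<integral>\<omega>. ?s \<omega> \<partial>M)"
    using integral_eq_nn_integral[OF sigma_tilde_measurable[OF t] pos] nn by simp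
qed

section \<open>Drift of the expected functions\<close>

definition drift :: "nat \<Rightarrow> 'w \<Rightarrow> ennreal" where
  "drift t \<omega> = lip_norm C (\<lambda>y. F t \<omega> y - F (t - 1) \<omega> y)"

lemma drift_measurable:
  assumes "t \<in> {1..T}"
  shows "drift t \<in> borel_measurable M"
  unfolding drift_def using C assms
  by (intro lip_norm_measurable borel_measurable_diff F_measurable) auto

lemma AE_drift_le:
  assumes t: "t \<in> {1..T}"
  shows "AE \<omega> in M. drift t \<omega> \<le> ennreal (2 * G)"
proof -
  have G2: "ennreal (2 * G) = ennreal G + ennreal G"
    using G by (subst ennreal_plus[symmetric]) auto
  have "AE \<omega> in M. lip_norm C (F t \<omega>) \<le> ennreal G" "AE \<omega> in M. lip_norm C (F (t - 1) \<omega>) \<le> ennreal G"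
    using t by (auto intro!: AE_F_lipschitz)
  then show ?thesis
  proof eventually_elim
    case (elim \<omega>)
    show ?case
      unfolding G2 drift_def by (rule order_trans[OF lip_norm_diff_le add_mono[OF elim]])
  qed
qed

lemma expected_drift:
  assumes t: "t \<in> {1..T}"
  defines "S \<equiv> \<lambda>\<omega>. SUP x\<in>X. (norm (expected_grad X \<DD> t \<omega> x - expected_grad X \<DD> (t - 1) \<omega> x))\<^sup>2"
  shows "integrable M (\<lambda>\<omega>. (enn2real (drift t \<omega>))\<^sup>2)" and "integrable M S"
    and "(\<integral>\<omega>. S \<omega> \<partial>M) = (\<integral>\<omega>. (enn2real (drift t \<omega>))\<^sup>2 \<partial>M)"
proof -
  let ?r = "\<lambda>\<omega>. (enn2real (drift t \<omega>))\<^sup>2"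
  have r_meas: "?r \<in> borel_measurable M"
    using drift_measurable[OF t] by measurable
  show r_int: "integrable M ?r"
  proof (rule integrable_const_bound[OF _ r_meas])
    show "AE \<omega> in M. norm (?r \<omega>) \<le> (2 * G)\<^sup>2"
      using AE_drift_le[OF t]
    proof eventually_elim
      case (elim \<omega>)
      then have "enn2real (drift t \<omega>) \<le> 2 * G" using G by (intro enn2real_leI) auto
      then show ?case using power_mono[of "enn2real (drift t \<omega>)" "2 * G" 2] by simp
    qed
  qed
  have S_eq: "S \<omega> = lip_sq C (\<lambda>y. F t \<omega> y - F (t - 1) \<omega> y)" if \<omega>: "\<omega> \<in> space M" for \<omega>
  proof -
    have d: "F t \<omega> differentiable_on X" "F (t - 1) \<omega> differentiable_on X"
      using t \<omega> by (auto intro!: F_differentiable)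
    have g: "expected_grad X \<DD> s \<omega> x = gradient_on X (F s \<omega>) x" if "x \<in> X" for s x
      using that convex by (simp add: expected_grad_def F_def)
    have "S \<omega> = (SUP x\<in>X. (norm (gradient_on X (\<lambda>y. F t \<omega> y - F (t - 1) \<omega> y) x))\<^sup>2)"
      unfolding S_def using gradient_on_diff[OF convex _ d] by (intro SUP_cong) (auto simp: g)
    also have "\<dots> = lip_sq C (\<lambda>y. F t \<omega> y - F (t - 1) \<omega> y)"
      using SUP_gradient_sq[OF convex nonempty C(2,3) differentiable_on_diff[OF d]] .
    finally show ?thesis .
  qed
  have "(\<lambda>\<omega>. lip_sq C (\<lambda>y. F t \<omega> y - F (t - 1) \<omega> y)) \<in> borel_measurable M"
    using C t by (intro lip_sq_measurable borel_measurable_diff F_measurable) auto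
  then have S_meas: "S \<in> borel_measurable M"
    by (simp add: S_eq cong: measurable_cong)
  have ae: "AE \<omega> in M. S \<omega> = ?r \<omega>"
    using AE_drift_le[OF t] AE_space
  proof eventually_elim
    case (elim \<omega>)
    then have "drift t \<omega> \<noteq> \<top>" by (auto simp: top_unique)
    then show ?case unfolding S_eq[OF elim(2)] drift_def by (rule lip_sq_finite)
  qed
  show "integrable M S"
    using r_int integrable_cong_AE[OF S_meas r_meas ae] by simp
  show "(\<integral>\<omega>. S \<omega> \<partial>M) = (\<integral>\<omega>. ?r \<omega> \<partial>M)"
    by (rule integral_cong_AE[OF S_meas r_meas ae])
qed

section \<open>Variation of the realised losses and its expectation\<close>

definition variation :: "nat \<Rightarrow> 'w \<Rightarrow> real" where
  "variation t \<omega> = enn2real (lip_norm C (\<lambda>y. f t \<omega> y - previous_loss (\<lambda>t. f t \<omega>) t y))"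

lemma previous_differentiable:
  assumes "t \<in> {1..T}" "\<omega> \<in> space M"
  shows "previous_loss (\<lambda>t. f t \<omega>) t differentiable_on X"
proof (cases "t \<le> 1")
  case False
  then have "t - 1 \<in> {1..T}" using assms by auto
  from f_differentiable[OF this assms(2)] show ?thesis using False by (simp add: previous_loss_def)
qed (simp add: previous_loss_def)

lemma previous_lipschitz:
  assumes "t \<in> {1..T}" "\<omega> \<in> space M"
  shows "lipschitz_bound X G (previous_loss (\<lambda>t. f t \<omega>) t)"
proof (cases "t \<le> 1")
  case True
  then show ?thesis using G by (simp add: previous_loss_def lipschitz_bound_def)
next
  case False
  then have "t - 1 \<in> {1..T}" using assms by auto
  from f_lipschitz[OF this assms(2)] show ?thesis using False by (simp add: previous_loss_def)
qed

lemma increment_continuous: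
  assumes "t \<in> {1..T}" "\<omega> \<in> space M"
  shows "continuous_on X (\<lambda>y. f t \<omega> y - previous_loss (\<lambda>t. f t \<omega>) t y)"
  by (intro differentiable_imp_continuous_on differentiable_on_diff f_differentiable
      previous_differentiable assms)

lemma variation_le:
  assumes "t \<in> {1..T}" "\<omega> \<in> space M" "0 \<le> L"
    and "lipschitz_bound X L (\<lambda>y. f t \<omega> y - previous_loss (\<lambda>t. f t \<omega>) t y)"
  shows "variation t \<omega> \<le> L"
  unfolding variation_def
  using lip_norm_le_iff[OF C(2,3) increment_continuous[OF assms(1,2)] assms(3)] assms(3,4)
  by (intro enn2real_leI) auto

lemma increment_lipschitz_G:
  assumes "t \<in> {1..T}" "\<omega> \<in> space M"
  shows "lipschitz_bound X (2 * G) (\<lambda>y. f t \<omega> y - previous_loss (\<lambda>t. f t \<omega>) t y)"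
  using lipschitz_bound_diff[OF f_lipschitz[OF assms] previous_lipschitz[OF assms]] by simp

lemma variation_le_G:
  assumes "t \<in> {1..T}" "\<omega> \<in> space M"
  shows "variation t \<omega> \<le> 2 * G"
  using G by (intro variation_le increment_lipschitz_G assms) simp

lemma variation_nonneg: "0 \<le> variation t \<omega>"
  by (simp add: variation_def)

text \<open>Holds at every sample point and not just almost surely, because the gradient bound does.
  It supplies the constants \<open>v\<close> of \<open>two_layer_regret\<close>.\<close>

lemma variation_lipschitz:
  assumes "t \<in> {1..T}" "\<omega> \<in> space M"
  shows "lipschitz_bound X (variation t \<omega>) (\<lambda>y. f t \<omega> y - previous_loss (\<lambda>t. f t \<omega>) t y)"
proof -
  note c = increment_continuous[OF assms]
  have "lip_norm C (\<lambda>y. f t \<omega> y - previous_loss (\<lambda>t. f t \<omega>) t y) \<le> ennreal (2 * G)"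
    using lip_norm_le_iff[OF C(2,3) c, of "2 * G"] increment_lipschitz_G[OF assms] G by simp
  then have "lip_norm C (\<lambda>y. f t \<omega> y - previous_loss (\<lambda>t. f t \<omega>) t y) \<noteq> \<top>"
    by (auto simp: top_unique)
  then show ?thesis unfolding variation_def by (rule lip_norm_lipschitz_bound[OF C(2,3) c])
qed

lemma variation_measurable:
  assumes t: "t \<in> {1..T}"
  shows "variation t \<in> borel_measurable M"
proof -
  have "(\<lambda>\<omega>. previous_loss (\<lambda>t. f t \<omega>) t y) \<in> borel_measurable M" if "y \<in> X" for y
  proof (cases "t \<le> 1")
    case False
    then have "t - 1 \<in> {1..T}" using t by auto
    from f_measurable[OF this that] show ?thesis using False by (simp add: previous_loss_def)
  qed (simp add: previous_loss_def)
  then have "(\<lambda>\<omega>. lip_norm C (\<lambda>y. f t \<omega> y - previous_loss (\<lambda>t. f t \<omega>) t y)) \<in> borel_measurable M"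
    using C t by (intro lip_norm_measurable borel_measurable_diff f_measurable) auto
  then show ?thesis unfolding variation_def by measurable
qed

definition total_variation :: "'w \<Rightarrow> real" where
  "total_variation \<omega> = (\<Sum>t=1..T. (variation t \<omega>)\<^sup>2)"

lemma total_variation_bounds:
  assumes "\<omega> \<in> space M"
  shows "0 \<le> total_variation \<omega>" "total_variation \<omega> \<le> 4 * real T * G\<^sup>2"
proof -
  show "0 \<le> total_variation \<omega>" unfolding total_variation_def by (intro sum_nonneg) auto
  have "total_variation \<omega> \<le> (\<Sum>t=1..T. (2 * G)\<^sup>2)"
    unfolding total_variation_def
    using variation_le_G variation_nonneg assms by (intro sum_mono power_mono) auto
  then show "total_variation \<omega> \<le> 4 * real T * G\<^sup>2" by (simp add: power_mult_distrib)
qed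

lemma total_variation_integrable: "integrable M total_variation"
proof (rule integrable_const_bound)
  show "AE \<omega> in M. norm (total_variation \<omega>) \<le> 4 * real T * G\<^sup>2"
    using total_variation_bounds by (intro AE_I2) simp
  show "total_variation \<in> borel_measurable M"
    unfolding total_variation_def using variation_measurable
    by (intro borel_measurable_sum borel_measurable_power) auto
qed

text \<open>Write \<open>f t - f (t - 1)\<close> as the deviation in round \<open>t\<close>, plus
  the drift, minus the deviation in round \<open>t - 1\<close>. The shifted sum of squared
  deviations is at most the unshifted one, and each squared deviation has the expectation of
  \<open>sigma_tilde_sq\<close>.\<close>

lemma expected_variation_le:
  "(\<integral>\<omega>. total_variation \<omega> \<partial>M)
    \<le> 6 * cumulative_sigma_tilde_sq M X T \<DD> + 3 * cumulative_Sigma_sq M X T \<DD>"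
proof -
  \<comment> \<open>The value 0 at index 0 reflects that both the zeroth loss and its mean are zero
    by convention; \<open>f 0\<close> and \<open>\<DD> 0\<close> themselves are arbitrary.\<close>
  define s where "s t \<omega> = (if t = 0 then 0 else enn2real (deviation (\<DD> t \<omega>) (f t \<omega>)))" for t \<omega>
  define r where "r t \<omega> = enn2real (drift t \<omega>)" for t \<omega>
  have "AE \<omega> in M. \<forall>t\<in>{1..T}. deviation (\<DD> t \<omega>) (f t \<omega>) \<le> ennreal (2 * G) \<and> drift t \<omega> \<le> ennreal (2 * G)"
    using AE_deviation_le(1) AE_drift_le by (intro AE_ball_countable') auto
  then have ae: "AE \<omega> in M. total_variation \<omega> \<le> 6 * (\<Sum>t=1..T. (s t \<omega>)\<^sup>2) + 3 * (\<Sum>t=1..T. (r t \<omega>)\<^sup>2)"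
    using AE_space
  proof eventually_elim
    case (elim \<omega>)
    note \<omega> = elim(2)
    have dev: "lipschitz_bound X (s t \<omega>) (\<lambda>y. f t \<omega> y - F t \<omega> y)" if t: "t \<in> {1..T}" for t
    proof -
      have "F t \<omega> = mean_fun X (\<DD> t \<omega>)" using t by (simp add: F_def)
      then have "lip_norm C (\<lambda>y. f t \<omega> y - F t \<omega> y) = deviation (\<DD> t \<omega>) (f t \<omega>)"
        by (simp add: deviation_def)
      moreover have "deviation (\<DD> t \<omega>) (f t \<omega>) \<le> ennreal (2 * G)" using elim(1) t by blast
      then have "deviation (\<DD> t \<omega>) (f t \<omega>) \<noteq> \<top>" by (auto simp: top_unique)
      moreover have "continuous_on X (\<lambda>y. f t \<omega> y - F t \<omega> y)"
        using t \<omega> by (intro differentiable_imp_continuous_on differentiable_on_diff f_differentiable F_differentiable) auto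
      ultimately show ?thesis
        using lip_norm_lipschitz_bound[OF C(2,3), of "\<lambda>y. f t \<omega> y - F t \<omega> y"] t by (simp add: s_def)
    qed
    have prev: "lipschitz_bound X (s (t - 1) \<omega>) (\<lambda>y. previous_loss (\<lambda>t. f t \<omega>) t y - F (t - 1) \<omega> y)"
      if t: "t \<in> {1..T}" for t
    proof (cases "t \<le> 1")
      case True
      then show ?thesis by (simp add: previous_loss_def F_def s_def lipschitz_bound_def)
    next
      case False
      then have "t - 1 \<in> {1..T}" using t by auto
      from dev[OF this] show ?thesis using False by (simp add: previous_loss_def)
    qed
    have dr: "lipschitz_bound X (r t \<omega>) (\<lambda>y. F t \<omega> y - F (t - 1) \<omega> y)" if t: "t \<in> {1..T}" for t
    proof -
      have "drift t \<omega> \<le> ennreal (2 * G)" using elim(1) t by blast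
      then have "drift t \<omega> \<noteq> \<top>" by (auto simp: top_unique)
      moreover have "continuous_on X (\<lambda>y. F t \<omega> y - F (t - 1) \<omega> y)"
        using t \<omega> by (intro differentiable_imp_continuous_on differentiable_on_diff F_differentiable) auto
      ultimately show ?thesis
        using lip_norm_lipschitz_bound[OF C(2,3), of "\<lambda>y. F t \<omega> y - F (t - 1) \<omega> y"]
        by (simp add: r_def drift_def)
    qed
    have s0: "0 \<le> s t \<omega>" and r0: "0 \<le> r t \<omega>" for t by (simp_all add: s_def r_def)
    have v: "variation t \<omega> \<le> s t \<omega> + r t \<omega> + s (t - 1) \<omega>" if t: "t \<in> {1..T}" for t
    proof (rule variation_le[OF t \<omega>])
      show "0 \<le> s t \<omega> + r t \<omega> + s (t - 1) \<omega>" by (intro add_nonneg_nonneg s0 r0)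
      show "lipschitz_bound X (s t \<omega> + r t \<omega> + s (t - 1) \<omega>)
          (\<lambda>y. f t \<omega> y - previous_loss (\<lambda>t. f t \<omega>) t y)"
        unfolding lipschitz_bound_def
      proof (intro ballI)
        fix y z assume yz: "y \<in> X" "z \<in> X"
        show "\<bar>f t \<omega> y - previous_loss (\<lambda>t. f t \<omega>) t y - (f t \<omega> z - previous_loss (\<lambda>t. f t \<omega>) t z)\<bar>
            \<le> (s t \<omega> + r t \<omega> + s (t - 1) \<omega>) * norm (y - z)"
          using lipschitz_boundD[OF dev[OF t] yz] lipschitz_boundD[OF prev[OF t] yz]
            lipschitz_boundD[OF dr[OF t] yz]
          unfolding distrib_right by linarith
      qed
    qed
    have "total_variation \<omega> \<le> (\<Sum>t=1..T. 3 * ((s t \<omega>)\<^sup>2 + (r t \<omega>)\<^sup>2 + (s (t - 1) \<omega>)\<^sup>2))"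
      unfolding total_variation_def
      using v variation_nonneg by (intro sum_mono order_trans[OF power_mono sum3_power2_le]) auto
    also have "\<dots> = 3 * (\<Sum>t=1..T. (s t \<omega>)\<^sup>2) + 3 * (\<Sum>t=1..T. (r t \<omega>)\<^sup>2)
        + 3 * (\<Sum>t=1..T. (s (t - 1) \<omega>)\<^sup>2)"
      by (simp add: sum.distrib distrib_left flip: sum_distrib_left)
    also have "(\<Sum>t=1..T. (s (t - 1) \<omega>)\<^sup>2) \<le> (\<Sum>t=1..T. (s t \<omega>)\<^sup>2)"
      by (rule sum_shift_le) (simp_all add: s_def)
    finally show ?case by simp
  qed
  have s_int: "integrable M (\<lambda>\<omega>. (s t \<omega>)\<^sup>2)" and s_eq: "(\<integral>\<omega>. (s t \<omega>)\<^sup>2 \<partial>M) = (\<integral>\<omega>. sigma_tilde_sq X (\<DD> t \<omega>) \<partial>M)"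
    if "t \<in> {1..T}" for t
    using expected_sigma_tilde[OF that] that by (simp_all add: s_def)
  have r_int: "integrable M (\<lambda>\<omega>. (r t \<omega>)\<^sup>2)" if "t \<in> {1..T}" for t
    using expected_drift[OF that] by (simp add: r_def)
  have "(\<integral>\<omega>. total_variation \<omega> \<partial>M)
      \<le> (\<integral>\<omega>. 6 * (\<Sum>t=1..T. (s t \<omega>)\<^sup>2) + 3 * (\<Sum>t=1..T. (r t \<omega>)\<^sup>2) \<partial>M)"
    using s_int r_int
    by (intro integral_mono_AE total_variation_integrable ae Bochner_Integration.integrable_add
        integrable_mult_right Bochner_Integration.integrable_sum) auto
  also have "\<dots> = (\<integral>\<omega>. 6 * (\<Sum>t=1..T. (s t \<omega>)\<^sup>2) \<partial>M) + (\<integral>\<omega>. 3 * (\<Sum>t=1..T. (r t \<omega>)\<^sup>2) \<partial>M)"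
    by (intro Bochner_Integration.integral_add integrable_mult_right Bochner_Integration.integrable_sum
        s_int r_int)
  also have "\<dots> = 6 * (\<Sum>t=1..T. \<integral>\<omega>. (s t \<omega>)\<^sup>2 \<partial>M) + 3 * (\<Sum>t=1..T. \<integral>\<omega>. (r t \<omega>)\<^sup>2 \<partial>M)"
    by (simp only: integral_mult_right_zero Bochner_Integration.integral_sum[OF s_int]
        Bochner_Integration.integral_sum[OF r_int])
  also have "(\<Sum>t=1..T. \<integral>\<omega>. (s t \<omega>)\<^sup>2 \<partial>M) = cumulative_sigma_tilde_sq M X T \<DD>"
    unfolding cumulative_sigma_tilde_sq_def using expected_sigma_tilde(2) s_eq by simp
  also have "(\<Sum>t=1..T. \<integral>\<omega>. (r t \<omega>)\<^sup>2 \<partial>M) = cumulative_Sigma_sq M X T \<DD>"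
    unfolding cumulative_Sigma_sq_def using expected_drift(2,3) by (simp add: r_def)
  finally show ?thesis .
qed

end

section \<open>Tuning the step size\<close>

lemma geometric_cover:
  fixes b z :: real
  assumes "b \<le> z" "z \<le> 2 * (b * 2 ^ (n - 1))" "n \<ge> 1"
  shows "\<exists>i\<in>{1..n}. b * 2 ^ (i - 1) \<le> z \<and> z \<le> 2 * (b * 2 ^ (i - 1))"
  using assms(3,2)
proof (induction n rule: dec_induct)
  case base
  then show ?case using assms(1) by (intro bexI[of _ 1]) auto
next
  case (step n)
  show ?case
  proof (cases "z \<le> 2 * (b * 2 ^ (n - 1))")
    case True
    then obtain i where "i \<in> {1..n}" "b * 2 ^ (i - 1) \<le> z \<and> z \<le> 2 * (b * 2 ^ (i - 1))"
      using step.IH by blast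
    then show ?thesis by (intro bexI[of _ i]) auto
  next
    case False
    have "2 * (b * 2 ^ (n - 1)) = b * 2 ^ (Suc n - 1)"
      using step.hyps by (cases n) auto
    then have "b * 2 ^ (Suc n - 1) \<le> z" using False by linarith
    then show ?thesis using step.prems by (intro bexI[of _ "Suc n"] conjI) auto
  qed
qed

text \<open>The left side is the quotient of the upper by the lower estimate for the ideal step size
  used in \<open>step_size_cover\<close>; the pool grows by factors of 2 until it covers this
  ratio.\<close>

lemma pool_range:
  assumes "G \<ge> 0"
  shows "sqrt ((1 + 2 * real T) * (1 + 4 * real T * G\<^sup>2)) \<le> 2 ^ (pool_size G T - 1)"
proof -
  define Y where "Y = (1 + 2 * real T) * (1 + 4 * real T * G\<^sup>2)"
  have Y: "Y > 0" unfolding Y_def by (intro mult_pos_pos add_pos_nonneg) auto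
  have "2 powr (1 / 2 * log 2 Y) = (2 powr log 2 Y) powr (1 / 2)"
    by (simp only: powr_powr mult.commute)
  then have "sqrt Y = 2 powr (1 / 2 * log 2 Y)"
    using Y by (simp add: powr_half_sqrt)
  also have "\<dots> \<le> 2 powr real (nat \<lceil>1 / 2 * log 2 Y\<rceil>)"
    by (intro powr_mono real_nat_ceiling_ge) simp
  also have "\<dots> = 2 ^ (pool_size G T - 1)"
    by (simp add: powr_realpow pool_size_def Y_def)
  finally show ?thesis by (simp add: Y_def)
qed

text \<open>\<open>z\<close> balances \<open>(D\<^sup>2 + 2 * D * P) / (2 * \<eta>)\<close> against
  \<open>\<eta> / 2 * (1 + V)\<close>. It is at least the first step of the pool, as seen from
  \<open>P = 0\<close> and maximal \<open>V\<close>, and at most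
  \<open>D * sqrt (1 + 2 * T)\<close>, as seen from maximal \<open>P\<close> and
  \<open>V = 0\<close>.\<close>

lemma step_size_cover:
  assumes D: "D > 0" and G: "G \<ge> 0" and T: "T \<ge> 1"
    and V: "0 \<le> V" "V \<le> 4 * real T * G\<^sup>2" and P: "0 \<le> P" "P \<le> (real T - 1) * D"
  defines "z \<equiv> sqrt (D\<^sup>2 + 2 * D * P) / sqrt (1 + V)"
  shows "\<exists>i\<in>{1..pool_size G T}. step_size D G T i \<le> z \<and> z \<le> 2 * step_size D G T i"
proof -
  define Q where "Q = sqrt (1 + 4 * real T * G\<^sup>2)"
  have Q: "Q \<ge> 1" "Q > 0"
    using add_pos_nonneg[of 1 "4 * real T * G\<^sup>2"] by (auto simp: Q_def)
  have "D \<le> sqrt (D\<^sup>2 + 2 * D * P)"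
    using D P by (intro real_le_rsqrt) auto
  moreover have "sqrt (1 + V) \<le> Q" "0 < sqrt (1 + V)" using V by (auto simp: Q_def)
  ultimately have low: "D / Q \<le> z"
    unfolding z_def using D P by (intro frac_le) auto
  have "2 * D * P \<le> 2 * D * ((real T - 1) * D)" using P(2) D by (intro mult_left_mono) auto
  also have "\<dots> = D\<^sup>2 * (2 * real T) - 2 * D\<^sup>2" by (simp add: power2_eq_square algebra_simps)
  also have "\<dots> \<le> D\<^sup>2 * (2 * real T)" by simp
  finally have "D\<^sup>2 + 2 * D * P \<le> D\<^sup>2 * (1 + 2 * real T)" by (simp only: distrib_left mult_1_right)
  then have "sqrt (D\<^sup>2 + 2 * D * P) \<le> sqrt (D\<^sup>2 * (1 + 2 * real T))" by (rule real_sqrt_le_mono)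
  also have "\<dots> = D * sqrt (1 + 2 * real T)" using D by (simp add: real_sqrt_mult)
  finally have num: "sqrt (D\<^sup>2 + 2 * D * P) \<le> D * sqrt (1 + 2 * real T)" .
  have "z \<le> sqrt (D\<^sup>2 + 2 * D * P) / 1"
    unfolding z_def using V D P by (intro divide_left_mono) auto
  also have "\<dots> \<le> D / Q * (sqrt (1 + 2 * real T) * Q)" using num Q by simp
  also have "\<dots> \<le> D / Q * 2 ^ (pool_size G T - 1)"
    using pool_range[OF G, of T] D Q by (intro mult_left_mono) (auto simp: Q_def real_sqrt_mult)
  also have "\<dots> \<le> 2 * (D / Q * 2 ^ (pool_size G T - 1))"
  proof -
    have "0 \<le> D / Q * 2 ^ (pool_size G T - 1)" using D Q by (intro mult_nonneg_nonneg) auto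
    then show ?thesis by linarith
  qed
  finally have "z \<le> 2 * (D / Q * 2 ^ (pool_size G T - 1))" .
  from geometric_cover[OF low this] show ?thesis
    by (simp add: step_size_def Q_def pool_size_def)
qed

text \<open>With \<open>w\<close> and \<open>s\<close> the two roots, a step within a factor 2 below
  \<open>w / s\<close> costs at most \<open>w * s + w * s / 2\<close>. What remains is to absorb
  \<open>w\<close> into \<open>(1 + D) * sqrt (1 + P)\<close> and \<open>s\<close> into the variance
  terms.\<close>

lemma tuned_bound:
  fixes D G N \<sigma> \<Sigma> :: real
  assumes D: "D > 0" and G: "G > 0" and N: "N \<ge> 1" and V: "0 \<le> V" "V \<le> 6 * \<sigma> + 3 * \<Sigma>"
    and pos: "0 \<le> \<sigma>" "0 \<le> \<Sigma>" "0 \<le> P"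
    and \<eta>: "\<eta> > 0" "\<eta> \<le> sqrt (D\<^sup>2 + 2 * D * P) / sqrt (1 + V)"
      "sqrt (D\<^sup>2 + 2 * D * P) / sqrt (1 + V) \<le> 2 * \<eta>"
  shows "(ln N + 1 + 2 * G * D) * (1 + D) * sqrt (1 + V) + (D\<^sup>2 + 2 * D * P) / (2 * \<eta>) + \<eta> / 2 * V
    \<le> 20 * (1 + D)\<^sup>2 * (1 + G) * (1 + ln N) * sqrt (1 + P) * (1 + sqrt \<sigma> + sqrt \<Sigma>)"
proof -
  define s where "s = sqrt (1 + V)"
  define w where "w = sqrt (D\<^sup>2 + 2 * D * P)"
  define R where "R = sqrt (1 + P)"
  define S where "S = 1 + sqrt \<sigma> + sqrt \<Sigma>"
  have s: "s > 0" "s\<^sup>2 = 1 + V" using V by (auto simp: s_def)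
  have w2: "w\<^sup>2 = D\<^sup>2 + 2 * D * P" using D pos by (simp add: w_def)
  have w: "w > 0" using D pos by (simp add: w_def add_pos_nonneg)
  have R: "R \<ge> 1" using pos by (simp add: R_def)
  have S: "S \<ge> 1" using pos by (simp add: S_def)
  have lnN: "ln N \<ge> 0" using N by simp
  have "w \<le> 2 * \<eta> * s" using \<eta>(3) s by (simp add: s_def[symmetric] w_def[symmetric] divide_le_eq)
  then have "w * w \<le> w * (2 * \<eta> * s)" using w by (intro mult_left_mono) auto
  then have "w\<^sup>2 \<le> w * s * (2 * \<eta>)" by (simp only: power2_eq_square mult_ac)
  then have 1: "(D\<^sup>2 + 2 * D * P) / (2 * \<eta>) \<le> w * s"
    unfolding w2[symmetric] using \<eta>(1) by (subst pos_divide_le_eq) auto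
  have "\<eta> / 2 * V \<le> (w / s) / 2 * s\<^sup>2"
    using \<eta>(1,2) s V w by (intro mult_mono divide_right_mono) (auto simp: s_def[symmetric] w_def[symmetric])
  also have "\<dots> = w * s / 2" using s(1) by (simp add: power2_eq_square)
  finally have 2: "\<eta> / 2 * V \<le> w * s / 2" .
  have "w\<^sup>2 \<le> ((1 + D) * R)\<^sup>2"
  proof -
    have "(1 + D)\<^sup>2 * (1 + P) = (D\<^sup>2 + 2 * D * P) + (1 + 2 * D + P + D\<^sup>2 * P)"
      by (simp add: power2_eq_square algebra_simps)
    moreover have "0 \<le> 1 + 2 * D + P + D\<^sup>2 * P" using D pos by (intro add_nonneg_nonneg) auto
    moreover have "((1 + D) * R)\<^sup>2 = (1 + D)\<^sup>2 * (1 + P)" using pos by (simp add: R_def power_mult_distrib)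
    ultimately show ?thesis unfolding w2 by linarith
  qed
  then have 3: "w \<le> (1 + D) * R" by (rule power2_le_imp_le) (use D R in auto)
  \<comment> \<open>Since \<open>1 + V \<le> 6 * (1 + \<sigma> + \<Sigma>)\<close>, any factor of at
    least \<open>sqrt 6\<close> works; \<open>5 / 2\<close> is a convenient one.\<close>
  have "s\<^sup>2 \<le> (5 / 2 * S)\<^sup>2"
  proof -
    have "S\<^sup>2 \<ge> 1 + \<sigma> + \<Sigma>"
    proof -
      have "S\<^sup>2 = 1 + (sqrt \<sigma>)\<^sup>2 + (sqrt \<Sigma>)\<^sup>2 + 2 * (sqrt \<sigma> + sqrt \<Sigma> + sqrt \<sigma> * sqrt \<Sigma>)"
        unfolding S_def by (simp add: power2_eq_square algebra_simps)
      then show ?thesis using pos by simp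
    qed
    then have "1 + V \<le> 25 / 4 * S\<^sup>2" using V pos by linarith
    then show ?thesis by (simp add: s power_mult_distrib power_divide)
  qed
  then have 4: "s \<le> 5 / 2 * S" by (rule power2_le_imp_le) (use S in auto)
  define c where "c = ln N + 1 + 2 * G * D"
  have c: "c \<ge> 1" using lnN D G by (simp add: c_def)
  have "c * (1 + D) * s + (D\<^sup>2 + 2 * D * P) / (2 * \<eta>) + \<eta> / 2 * V \<le> (c * (1 + D) + 3 / 2 * w) * s"
  proof -
    have "(c * (1 + D) + 3 / 2 * w) * s = c * (1 + D) * s + w * s + w * s / 2"
      by (simp add: algebra_simps)
    then show ?thesis using 1 2 by linarith
  qed
  also have "\<dots> \<le> (c * (1 + D) * R + 3 / 2 * ((1 + D) * R)) * s"
    using 3 s R c D by (intro mult_right_mono add_mono) auto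
  also have "\<dots> = (c + 3 / 2) * (1 + D) * R * s" by (simp add: algebra_simps)
  also have "\<dots> \<le> (c + 3 / 2) * (1 + D) * R * (5 / 2 * S)"
    using 4 c D R by (intro mult_left_mono) auto
  also have "\<dots> = (5 / 2 * (c + 3 / 2)) * ((1 + D) * R * S)" by simp
  also have "\<dots> \<le> (20 * (1 + D) * (1 + G) * (1 + ln N)) * ((1 + D) * R * S)"
  proof (rule mult_right_mono)
    \<comment> \<open>Expanding \<open>(1 + D) * (1 + G) * (1 + ln N)\<close> gives
      \<open>1 + r + ln N\<close> plus the nonnegative rest \<open>q\<close>, and only the former is
      needed.\<close>
    define q where "q = D + G + G * ln N + D * ln N + G * D * ln N"
    define r where "r = G * D"
    have r: "r \<ge> 0" using D G by (simp add: r_def)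
    have q: "q \<ge> 0"
      unfolding q_def using D G lnN by (intro add_nonneg_nonneg mult_nonneg_nonneg) auto
    have "5 / 2 * (c + 3 / 2) = 5 / 2 * ln N + 5 * r + 25 / 4"
      by (simp add: c_def r_def algebra_simps)
    also have "\<dots> \<le> 20 * (1 + r + ln N) + 20 * q" using lnN q r by simp
    also have "\<dots> = 20 * (1 + D) * (1 + G) * (1 + ln N)"
      by (simp add: q_def r_def algebra_simps)
    finally show "5 / 2 * (c + 3 / 2) \<le> 20 * (1 + D) * (1 + G) * (1 + ln N)" .
  qed (use D R S in auto)
  also have "\<dots> = 20 * (1 + D)\<^sup>2 * (1 + G) * (1 + ln N) * R * S"
    by (simp add: power2_eq_square)
  finally show ?thesis by (simp add: c_def s_def R_def S_def)
qed

text \<open>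
  The step size is tuned to the expectations of the variation and of the path length, hence it is
  the same for all sample points.  Linearising the square root at the expectation reduces the
  remaining step to linearity of the integral.
\<close>

lemma sqrt_linearise:
  assumes "0 \<le> D" "0 \<le> V" "0 \<le> EV"
  shows "sqrt (1 + D\<^sup>2 * V) \<le> (1 + D) * ((1 + V) / (2 * sqrt (1 + EV)) + sqrt (1 + EV) / 2)"
proof -
  define s where "s = sqrt (1 + EV)"
  define y where "y = sqrt (1 + V)"
  have s: "s > 0" and y: "y\<^sup>2 = 1 + V" using assms by (auto simp: s_def y_def)
  have "1 + D\<^sup>2 * V \<le> (1 + D)\<^sup>2 * (1 + V)"
  proof -
    have "D\<^sup>2 \<le> (1 + D)\<^sup>2" "1 \<le> (1 + D)\<^sup>2" using assms by (auto simp: power2_eq_square algebra_simps)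
    then show ?thesis using mult_right_mono[of "D\<^sup>2" "(1 + D)\<^sup>2" V] assms
      unfolding distrib_left by linarith
  qed
  then have "sqrt (1 + D\<^sup>2 * V) \<le> sqrt ((1 + D)\<^sup>2 * (1 + V))" by (rule real_sqrt_le_mono)
  also have "\<dots> = (1 + D) * y" using assms by (simp add: real_sqrt_mult y_def)
  also have "y \<le> y\<^sup>2 / (2 * s) + s / 2"
  proof -
    have "0 \<le> (y - s)\<^sup>2" by simp
    then show ?thesis using s by (simp add: field_simps power2_eq_square)
  qed
  finally show ?thesis using assms by (simp add: y s_def mult_left_mono)
qed

theorem theorem9:
  fixes M :: "'w measure"
    and X :: "'a::euclidean_space set"
    and T :: nat
    and D G :: real
    and \<DD> :: "nat \<Rightarrow> 'w \<Rightarrow> ('a \<Rightarrow> real) measure"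
    and f :: "nat \<Rightarrow> 'w \<Rightarrow> 'a \<Rightarrow> real"
    and u play :: "nat \<Rightarrow> 'w \<Rightarrow> 'a"
    and x_ref :: 'a
    and x0 :: "nat \<Rightarrow> 'a"
    and xh x :: "nat \<Rightarrow> nat \<Rightarrow> 'w \<Rightarrow> 'a"
    and p :: "nat \<Rightarrow> nat \<Rightarrow> 'w \<Rightarrow> real"
  assumes "T \<ge> 1"
    and "closed X" and "convex X"
    and "SEA_model M X T \<DD> f"
    and "G > 0" and "D > 0"
    and gradient_bound: "\<forall>\<omega>\<in>space M. \<forall>t\<in>{1..T}. \<forall>y\<in>X. norm (gradient_on X (f t \<omega>) y) \<le> G"
    and domain: "0 \<in> X" "\<forall>y\<in>X. \<forall>z\<in>X. norm (y - z) \<le> D"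
    and convexity: "\<forall>\<omega>\<in>space M. \<forall>t\<in>{1..T}. convex_on X (f t \<omega>)"
    and reference: "x_ref \<in> X"
    and initial: "\<forall>i\<in>{1..pool_size G T}. x0 i \<in> X"
    and algorithm: "\<forall>\<omega>\<in>space M.
      two_layer_run X T (pool_size G T) (step_size D G T) x_ref x0 (\<lambda>t. f t \<omega>)
        (\<lambda>t i. xh t i \<omega>) (\<lambda>t i. x t i \<omega>) (\<lambda>t i. p t i \<omega>) (\<lambda>t. play t \<omega>)"
    and comparators: "admissible_comparators M X T \<DD> f u"
  shows "(\<integral>\<omega>. (\<Sum>t=1..T. f t \<omega> (play t \<omega>)) - (\<Sum>t=1..T. f t \<omega> (u t \<omega>)) \<partial>M)
    \<le> regret_const D G (pool_size G T) * sqrt (1 + path_length M T u)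
       * (1 + sqrt (cumulative_sigma_tilde_sq M X T \<DD>) + sqrt (cumulative_Sigma_sq M X T \<DD>))"
proof -
  obtain C where C: "countable C" "C \<subseteq> X" "X \<subseteq> closure C"
    using separable[of X] by blast
  interpret lipschitz_sea M X T \<DD> f G C
    by standard (use assms C in auto)
  let ?N = "pool_size G T"
  let ?R = "\<lambda>\<omega>. (\<Sum>t=1..T. f t \<omega> (play t \<omega>)) - (\<Sum>t=1..T. f t \<omega> (u t \<omega>))"
  define P where "P \<omega> = (\<Sum>t=2..T. norm (u t \<omega> - u (t - 1) \<omega>))" for \<omega>
  define EP where "EP = (\<integral>\<omega>. P \<omega> \<partial>M)"
  define EV where "EV = (\<integral>\<omega>. total_variation \<omega> \<partial>M)"
  define c where "c = ln (real ?N) + 1 + 2 * G * D"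
  have EP: "path_length M T u = EP" by (simp add: path_length_def EP_def P_def)
  have N: "real ?N \<ge> 1" by (simp add: pool_size_def)
  have c: "c \<ge> 0" using N \<open>G > 0\<close> \<open>D > 0\<close> by (simp add: c_def)
  have u_meas: "u t \<in> borel_measurable M" and u: "\<And>\<omega>. \<omega> \<in> space M \<Longrightarrow> u t \<omega> \<in> X" if "t \<in> {1..T}" for t
    using comparators that by (auto simp: admissible_comparators_def)

  have P_bounds: "0 \<le> P \<omega>" "P \<omega> \<le> (real T - 1) * D" if \<omega>: "\<omega> \<in> space M" for \<omega>
  proof -
    show "0 \<le> P \<omega>" unfolding P_def by (intro sum_nonneg) auto
    have "P \<omega> \<le> (\<Sum>t=2..T. D)"
      unfolding P_def
    proof (rule sum_mono)
      fix t assume "t \<in> {2..T}"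
      then have "t \<in> {1..T}" "t - 1 \<in> {1..T}" by auto
      then show "norm (u t \<omega> - u (t - 1) \<omega>) \<le> D" using u \<omega> domain(2) by blast
    qed
    then show "P \<omega> \<le> (real T - 1) * D" using \<open>T \<ge> 1\<close> by (simp add: of_nat_diff)
  qed
  have P_meas: "P \<in> borel_measurable M"
    unfolding P_def
  proof (rule borel_measurable_sum)
    fix t assume "t \<in> {2..T}"
    then have "t \<in> {1..T}" "t - 1 \<in> {1..T}" by auto
    from this[THEN u_meas]
    show "(\<lambda>\<omega>. norm (u t \<omega> - u (t - 1) \<omega>)) \<in> borel_measurable M"
      by measurable
  qed
  have P_int: "integrable M P"
    using P_bounds by (intro integrable_const_bound[OF _ P_meas] AE_I2) auto
  have EP_bounds: "0 \<le> EP" "EP \<le> (real T - 1) * D"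
  proof -
    show "0 \<le> EP" unfolding EP_def by (rule Bochner_Integration.integral_nonneg[OF P_bounds(1)])
    have "EP \<le> (\<integral>\<omega>. (real T - 1) * D \<partial>M)"
      unfolding EP_def using P_bounds P_int by (intro integral_mono) auto
    then show "EP \<le> (real T - 1) * D" by (simp add: prob_space)
  qed
  have EV_bounds: "0 \<le> EV" "EV \<le> 4 * real T * G\<^sup>2"
  proof -
    show "0 \<le> EV" unfolding EV_def by (rule Bochner_Integration.integral_nonneg[OF total_variation_bounds(1)])
    have "EV \<le> (\<integral>\<omega>. 4 * real T * G\<^sup>2 \<partial>M)"
      unfolding EV_def using total_variation_bounds total_variation_integrable
      by (intro integral_mono) auto
    then show "EV \<le> 4 * real T * G\<^sup>2" by (simp add: prob_space)
  qed
  obtain i where i: "i \<in> {1..?N}"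
    and \<eta>: "step_size D G T i \<le> sqrt (D\<^sup>2 + 2 * D * EP) / sqrt (1 + EV)"
      "sqrt (D\<^sup>2 + 2 * D * EP) / sqrt (1 + EV) \<le> 2 * step_size D G T i"
    using step_size_cover[OF \<open>D > 0\<close> _ \<open>T \<ge> 1\<close> EV_bounds EP_bounds] \<open>G > 0\<close> by auto
  define e where "e = step_size D G T i"
  have steps: "step_size D G T j > 0" for j
    unfolding step_size_def using \<open>D > 0\<close> add_pos_nonneg[of 1 "4 * real T * G\<^sup>2"]
    by (intro mult_pos_pos divide_pos_pos) auto
  then have e: "e > 0" by (simp add: e_def)
  define s where "s = sqrt (1 + EV)"
  have s: "s > 0" "s * s = 1 + EV" using EV_bounds by (auto simp: s_def)
  \<comment> \<open>An integrable majorant of the regret: it is affine in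
    \<open>total_variation\<close> and \<open>P\<close>, so its expectation needs only
    \<open>EV\<close> and \<open>EP\<close>.\<close>
  define B where "B \<omega> = c * ((1 + D) * ((1 + total_variation \<omega>) / (2 * s) + s / 2))
    + (D\<^sup>2 + 2 * D * P \<omega>) / (2 * e) + e / 2 * total_variation \<omega>" for \<omega>
  have path: "?R \<omega> \<le> B \<omega>" if \<omega>: "\<omega> \<in> space M" for \<omega>
  proof -
    have "?R \<omega> \<le> (ln (real ?N) + 1 + (2 * G) * D) * sqrt (1 + D\<^sup>2 * (\<Sum>t=1..T. (variation t \<omega>)\<^sup>2))
      + (D\<^sup>2 + 2 * D * (\<Sum>t=2..T. norm (u t \<omega> - u (t - 1) \<omega>))) / (2 * step_size D G T i)
      + step_size D G T i / 2 * (\<Sum>t=1..T. (variation t \<omega>)\<^sup>2)"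
    proof (rule two_layer_regret[where X = X and f = "\<lambda>t. f t \<omega>" and play = "\<lambda>t. play t \<omega>"
          and u = "\<lambda>t. u t \<omega>" and v = "\<lambda>t. variation t \<omega>" and start = x0 and x_ref = x_ref])
      show "two_layer_run X T ?N (step_size D G T) x_ref x0 (\<lambda>t. f t \<omega>)
        (\<lambda>t i. xh t i \<omega>) (\<lambda>t i. x t i \<omega>) (\<lambda>t i. p t i \<omega>) (\<lambda>t. play t \<omega>)"
        using algorithm \<omega> by blast
    qed (use assms \<omega> i u steps f_differentiable variation_lipschitz variation_nonneg variation_le_G in auto)
    also have "\<dots> = c * sqrt (1 + D\<^sup>2 * total_variation \<omega>) + (D\<^sup>2 + 2 * D * P \<omega>) / (2 * e) + e / 2 * total_variation \<omega>"
      by (simp add: c_def P_def e_def total_variation_def)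
    also have "\<dots> \<le> B \<omega>"
      unfolding B_def s_def using c \<open>D > 0\<close> EV_bounds total_variation_bounds[OF \<omega>]
      by (intro add_right_mono mult_left_mono sqrt_linearise) auto
    finally show ?thesis .
  qed
  have B_int: "integrable M B"
    unfolding B_def using P_int total_variation_integrable by simp
  have "(\<integral>\<omega>. B \<omega> \<partial>M) = c * ((1 + D) * ((1 + EV) / (2 * s) + s / 2))
    + (D\<^sup>2 + 2 * D * EP) / (2 * e) + e / 2 * EV"
    unfolding B_def using P_int total_variation_integrable
    by (simp add: prob_space EV_def EP_def)
  \<comment> \<open>The linearisation is exact at the expectation, so integrating it returns the
    root of \<open>1 + EV\<close>.\<close>
  also have "(1 + EV) / (2 * s) + s / 2 = s"
    using s(1) by (simp add: s(2)[symmetric])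
  finally have EB: "(\<integral>\<omega>. B \<omega> \<partial>M) = c * (1 + D) * s + (D\<^sup>2 + 2 * D * EP) / (2 * e) + e / 2 * EV"
    by simp
  have cum: "0 \<le> cumulative_sigma_tilde_sq M X T \<DD>" "0 \<le> cumulative_Sigma_sq M X T \<DD>"
  proof -
    have "0 \<le> (\<Sum>t=1..T. \<integral>\<omega>. sigma_tilde_sq X (\<DD> t \<omega>) \<partial>M)"
      using expected_sigma_tilde(3) by (intro sum_nonneg) (simp add: integral_nonneg_AE)
    then show "0 \<le> cumulative_sigma_tilde_sq M X T \<DD>"
      unfolding cumulative_sigma_tilde_sq_def using expected_sigma_tilde(2) by simp
    show "0 \<le> cumulative_Sigma_sq M X T \<DD>"
      unfolding cumulative_Sigma_sq_def using expected_drift(2,3) by (simp add: sum_nonneg)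
  qed
  have bound: "(\<integral>\<omega>. B \<omega> \<partial>M) \<le> 20 * (1 + D)\<^sup>2 * (1 + G) * (1 + ln (real ?N)) * sqrt (1 + EP)
       * (1 + sqrt (cumulative_sigma_tilde_sq M X T \<DD>) + sqrt (cumulative_Sigma_sq M X T \<DD>))"
    unfolding EB c_def s_def e_def
    by (rule tuned_bound[OF \<open>D > 0\<close> \<open>G > 0\<close> N EV_bounds(1) _ cum EP_bounds(1) steps \<eta>])
      (use expected_variation_le in \<open>simp add: EV_def\<close>)
  have "(\<integral>\<omega>. ?R \<omega> \<partial>M) \<le> 20 * (1 + D)\<^sup>2 * (1 + G) * (1 + ln (real ?N)) * sqrt (1 + EP)
       * (1 + sqrt (cumulative_sigma_tilde_sq M X T \<DD>) + sqrt (cumulative_Sigma_sq M X T \<DD>))"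
  proof (cases "integrable M ?R")
    case True
    have "(\<integral>\<omega>. ?R \<omega> \<partial>M) \<le> (\<integral>\<omega>. B \<omega> \<partial>M)"
      by (intro integral_mono True B_int path)
    with bound show ?thesis by linarith
  next
    \<comment> \<open>The integral of a non-integrable function is 0 by convention, so a nonnegative
      right side suffices.\<close>
    case False
    have "0 \<le> 20 * (1 + D)\<^sup>2 * (1 + G) * (1 + ln (real ?N)) * sqrt (1 + EP)
       * (1 + sqrt (cumulative_sigma_tilde_sq M X T \<DD>) + sqrt (cumulative_Sigma_sq M X T \<DD>))"
      using N \<open>G > 0\<close> \<open>D > 0\<close> cum EP_bounds
      by (intro mult_nonneg_nonneg add_nonneg_nonneg) auto
    then show ?thesis using False by (simp add: not_integrable_integral_eq)
  qed
  then show ?thesis by (simp add: regret_const_def EP)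
qed

end
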